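(* Let $p\in(0,1)$ be a constant and let $G=G_p\in\mathcal{G}_{n,p}$ be a random graph. Let $RW(G)$ be the reverse Wiener matrix of $G$, with $(i,j)$-entry $D(G)-D(i,j)$ if $i\neq j$ and $0$ if $i=j$, where $D(G)$ is the diameter of $G$. Then $$\mathscr{E}(RW(G))=\Big(\frac{8}{3\pi}\sqrt{p(1-p)}+o(1)\Big)n^{3/2}\quad\text{a.s.}$$
   Context: $D(i,j)$ is the distance between vertices $i$ and $j$ in $G$. The energy of a real symmetric matrix $M$ with eigenvalues $\lambda_1,\dots,\lambda_n$ is $\mathscr{E}(M)=\sum_{i=1}^n|\lambda_i|$. $\mathcal{G}_{n,p}$ is the Erdős–Rényi random graph model on $n$ vertices, each edge chosen independently with probability $p$. "a.s." means with probability tending to $1$ as $n\to\infty$; the $o(1)$ term is bounded in absolute value by a deterministic sequence tending to $0$ with probability tending to $1$. (With probability tending to $1$ the graph is connected with diameter $2$, so the convention for distances and diameter in disconnected graphs is irrelevant.) *)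

theory Defs
  imports
    "HOL-Probability.Probability"
    "HOL-Computational_Algebra.Computational_Algebra"
    "Jordan_Normal_Form.Char_Poly"
    "Graph_Theory.Graph_Theory"
begin

(* Energy of a real symmetric matrix: proots lists the roots of the characteristic polynomial
   with multiplicity, so for symmetric M these are all of its eigenvalues. *)
definition matrix_energy :: "real mat \<Rightarrow> real" where
  "matrix_energy M = (\<Sum>x\<in>#proots (char_poly M). \<bar>x\<bar>)"

(* Undirected simple graphs are symmetric loop-free digraphs without multiple arcs (pair_graph). *)

definition graph_dist :: "'a pair_pre_digraph \<Rightarrow> 'a \<Rightarrow> 'a \<Rightarrow> ereal" where
  "graph_dist G u v = wf_digraph.\<mu> (with_proj G) (\<lambda>_. 1) u v"

definition graph_diameter :: "'a pair_pre_digraph \<Rightarrow> ereal" where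
  "graph_diameter G = (SUP u\<in>pverts G. SUP v\<in>pverts G. graph_dist G u v)"

(* For graphs with vertex set {..<n}. In a disconnected graph, infinite distances and the
   infinite diameter are read as 0 by real_of_ereal. *)
definition reverse_wiener :: "nat pair_pre_digraph \<Rightarrow> real mat" where
  "reverse_wiener G = Matrix.mat (card (pverts G)) (card (pverts G)) (\<lambda>(i, j).
     if i = j then 0 else real_of_ereal (graph_diameter G) - real_of_ereal (graph_dist G i j))"

definition vertex_pairs :: "nat \<Rightarrow> nat set set" where
  "vertex_pairs n = {e. e \<subseteq> {..<n} \<and> card e = 2}"

definition graph_of_edges :: "nat \<Rightarrow> (nat set \<Rightarrow> bool) \<Rightarrow> nat pair_pre_digraph" where
  "graph_of_edges n X =
     \<lparr>pverts = {..<n}, parcs = {(i, j). {i, j} \<in> vertex_pairs n \<and> X {i, j}}\<rparr>"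

(* The Erdos-Renyi model: one independent Bernoulli(p) variable for each unordered pair. *)
definition gnp_pmf :: "nat \<Rightarrow> real \<Rightarrow> nat pair_pre_digraph pmf" where
  "gnp_pmf n p =
     map_pmf (graph_of_edges n) (Pi_pmf (vertex_pairs n) False (\<lambda>_. bernoulli_pmf p))"

lemma pair_graph_graph_of_edges: "pair_graph (graph_of_edges n X)"
proof -
  have "finite (parcs (graph_of_edges n X))"
    by (rule finite_subset[of _ "{..<n} \<times> {..<n}"])
       (auto simp: graph_of_edges_def vertex_pairs_def)
  then show ?thesis
    by unfold_locales
       (auto simp: graph_of_edges_def vertex_pairs_def symmetric_def sym_def insert_commute)
qed

end

theory Submission
  imports Defs "Jordan_Normal_Form.Schur_Decomposition" "HOL-Real_Asymp.Real_Asymp"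
begin

text \<open>
  With probability tending to one any two vertices have a common neighbour and some two vertices
  are not adjacent. Then all distances off the diagonal are 1 or 2 and both occur, so the reverse
  Wiener matrix is the adjacency matrix \<open>A\<close>, and the claim is one about the energy of \<open>A\<close>: with
  \<open>\<lambda>\<close> ranging over the eigenvalues of \<open>A / sqrt n\<close> and \<open>v = p * (1 - p)\<close>, the average of \<open>\<bar>\<lambda>\<bar>\<close>
  converges in \<open>L1\<close> to \<open>8 * sqrt v / (3 * pi)\<close>, the first absolute moment of the semicircle law of
  variance \<open>v\<close>.

  The proof works with resolvents on the imaginary axis. Since
  \<open>\<bar>x\<bar> = (2 / pi) * (integral over t > 0 of x^2 / (x^2 + t^2))\<close>, and since the integrand equals
  \<open>1 - t * Re (1 / (t + \<i> * x))\<close>, the average of \<open>\<bar>\<lambda>\<bar>\<close> is determined by the normalized trace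
  \<open>w = tr W / n\<close> of the resolvent \<open>W = (t + \<i> * A / sqrt n)^(-1)\<close> for \<open>t > 0\<close>. On this half-line
  everything is elementary: \<open>W\<close> has operator norm at most \<open>1 / t\<close>, because \<open>\<i> * A / sqrt n\<close>
  is skew-Hermitian.

  The trace satisfies an approximate quadratic equation. The trace of \<open>(t + \<i> * A / sqrt n) * W = 1\<close>
  contains the products of an entry of \<open>A\<close> with an entry of \<open>W\<close>. For a Bernoulli variable \<open>x\<close> one has
  \<open>E (x * f x) = p * E (f x) + v * (f 1 - f 0)\<close> exactly; so the expected products are, up to
  lower order, differences of resolvents of two graphs that differ in a single edge, which the resolvent
  identity turns into products of resolvent entries. What remains is \<open>t * E w + v * E (w^2) = 1\<close>
  with an error of order \<open>1 / sqrt n\<close> (\<open>self_consistency_in_expectation\<close>). As one edge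
  changes \<open>w\<close> by at most a constant times \<open>n^(-3/2)\<close>, the Efron-Stein inequality bounds the
  variance of \<open>w\<close> by a constant over \<open>n\<close> (\<open>w_variance\<close>). Hence \<open>E w\<close> almost solves
  \<open>t * z + v * z^2 = 1\<close>, and it has a nonnegative real part; this forces it to be close to the
  positive root \<open>h t\<close> of the equation (\<open>w_close_to_semicircle\<close>).

  Finally \<open>1 - t * h t\<close> has an elementary primitive, and its integral over \<open>t > 0\<close> is
  \<open>4 / 3 * sqrt v\<close>. Cutting the integral off at \<open>d\<close> and \<open>1 / d\<close> costs \<open>O(d)\<close>, because the
  squares of the eigenvalues of \<open>A / sqrt n\<close> have average at most 1. Markov's inequality turns the
  \<open>L1\<close> convergence into the statement about probabilities.
\<close>

unbundle no vec_syntax and no fps_syntax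

section \<open>Functions of independent Bernoulli variables\<close>

abbreviation bernoulli_product :: "'a set \<Rightarrow> real \<Rightarrow> ('a \<Rightarrow> bool) pmf" where
  "bernoulli_product S p \<equiv> Pi_pmf S False (\<lambda>_. bernoulli_pmf p)"

lemma finite_set_bernoulli_product [simp]:
  "finite S \<Longrightarrow> finite (set_pmf (bernoulli_product S p))"
  by (rule finite_subset[OF set_Pi_pmf_subset']) (auto intro!: finite_PiE_dflt)

lemma integrable_bernoulli_product [simp]:
  fixes f :: "_ \<Rightarrow> 'b :: {banach, second_countable_topology}"
  shows "finite S \<Longrightarrow> integrable (measure_pmf (bernoulli_product S p)) f"
  by (simp add: integrable_measure_pmf_finite)

lemma expectation_insert:
  fixes f :: "('a \<Rightarrow> bool) \<Rightarrow> 'b :: {banach, second_countable_topology}"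
  assumes "finite A" "e \<notin> A" "0 \<le> p" "p \<le> 1"
  shows "measure_pmf.expectation (bernoulli_product (insert e A) p) f =
    p *\<^sub>R measure_pmf.expectation (bernoulli_product A p) (\<lambda>X. f (X(e := True))) +
    (1 - p) *\<^sub>R measure_pmf.expectation (bernoulli_product A p) (\<lambda>X. f (X(e := False)))"
proof -
  have "measure_pmf.expectation (bernoulli_product (insert e A) p) f =
     measure_pmf.expectation (bernoulli_pmf p \<bind>
       (\<lambda>y. map_pmf (\<lambda>X. X(e := y)) (bernoulli_product A p))) f"
    using assms by (simp add: Pi_pmf_insert' map_pmf_def)
  also have "\<dots> =
    p *\<^sub>R measure_pmf.expectation (bernoulli_product A p) (\<lambda>X. f (X(e := True))) +
    (1 - p) *\<^sub>R measure_pmf.expectation (bernoulli_product A p) (\<lambda>X. f (X(e := False)))"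
    by (subst pmf_expectation_bind[of UNIV])
       (use assms in \<open>auto simp: UNIV_bool add.commute\<close>)
  finally show ?thesis .
qed

lemma expectation_resample:
  fixes f :: "('a \<Rightarrow> bool) \<Rightarrow> 'b :: {banach, second_countable_topology}"
  assumes "finite S" "e \<in> S" "0 \<le> p" "p \<le> 1"
  shows "measure_pmf.expectation (bernoulli_product S p) f =
    p *\<^sub>R measure_pmf.expectation (bernoulli_product S p) (\<lambda>X. f (X(e := True))) +
    (1 - p) *\<^sub>R measure_pmf.expectation (bernoulli_product S p) (\<lambda>X. f (X(e := False)))"
proof -
  define A where "A = S - {e}"
  have A: "finite A" "e \<notin> A" "S = insert e A"
    using assms by (auto simp: A_def)
  have "measure_pmf.expectation (bernoulli_product S p) (\<lambda>X. f (X(e := b))) =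
      measure_pmf.expectation (bernoulli_product A p) (\<lambda>X. f (X(e := b)))" for b
    unfolding \<open>S = insert e A\<close> using A assms
    by (subst expectation_insert) (auto simp flip: scaleR_left.add)
  then show ?thesis
    unfolding \<open>S = insert e A\<close> using A assms by (subst expectation_insert) auto
qed

text \<open>
  The discrete integration by parts for one bit. Conditionally on the other bits both sides are linear
  in the two values of \<open>f\<close>, and the coefficients agree: \<open>p = p * p + p * (1 - p)\<close> at 1 and
  \<open>0 = (1 - p) * p - p * (1 - p)\<close> at 0. It replaces the Gaussian integration by parts of the
  usual resolvent method and carries no error term.
\<close>

lemma expectation_bit_times:
  fixes f :: "('a \<Rightarrow> bool) \<Rightarrow> 'b :: {banach, second_countable_topology}"
  assumes S: "finite S" "e \<in> S" and p: "0 \<le> p" "p \<le> 1"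
  shows "measure_pmf.expectation (bernoulli_product S p) (\<lambda>X. of_bool (X e) *\<^sub>R f X) =
    p *\<^sub>R measure_pmf.expectation (bernoulli_product S p) f +
    (p * (1 - p)) *\<^sub>R measure_pmf.expectation (bernoulli_product S p)
       (\<lambda>X. f (X(e := True)) - f (X(e := False)))"
proof -
  let ?E = "measure_pmf.expectation (bernoulli_product S p) :: _ \<Rightarrow> 'b"
  define a b where "a = ?E (\<lambda>X. f (X(e := True)))" and "b = ?E (\<lambda>X. f (X(e := False)))"
  have "?E (\<lambda>X. of_bool (X e) *\<^sub>R f X) = p *\<^sub>R a"
    using assms by (subst expectation_resample[of _ e]) (auto simp: a_def)
  moreover have "?E f = p *\<^sub>R a + (1 - p) *\<^sub>R b"
    using assms by (subst expectation_resample[of _ e]) (auto simp: a_def b_def)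
  moreover have "?E (\<lambda>X. f (X(e := True)) - f (X(e := False))) = a - b"
    using S by (simp add: a_def b_def)
  ultimately show ?thesis
    by (simp only:) (simp add: algebra_simps)
qed

lemma expectation_bit_times_indep:
  fixes f :: "('a \<Rightarrow> bool) \<Rightarrow> real"
  assumes "finite S" "e \<in> S" "0 \<le> p" "p \<le> 1"
    and indep: "\<And>X b. f (X(e := b)) = f X"
  shows "measure_pmf.expectation (bernoulli_product S p) (\<lambda>X. of_bool (X e) * f X) =
    p * measure_pmf.expectation (bernoulli_product S p) f"
  using expectation_bit_times[OF assms(1-4), of f] by (simp add: indep)

text \<open>
  Induction over the bits: conditioning on one bit splits the variance into the average of the
  conditional variances, handled by the induction hypothesis, and the variance of the conditional
  mean. The latter takes two values at distance at most \<open>c e\<close>, so it contributes at most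
  \<open>p * (1 - p) * (c e)\<^sup>2\<close>.
\<close>

lemma efron_stein_bernoulli:
  fixes f :: "('a \<Rightarrow> bool) \<Rightarrow> real"
  assumes "finite S" and p: "0 \<le> p" "p \<le> 1"
    and "\<And>X e. e \<in> S \<Longrightarrow> \<bar>f (X(e := True)) - f (X(e := False))\<bar> \<le> c e"
  shows "measure_pmf.expectation (bernoulli_product S p) (\<lambda>X. (f X)\<^sup>2) -
      (measure_pmf.expectation (bernoulli_product S p) f)\<^sup>2 \<le> (\<Sum>e\<in>S. (c e)\<^sup>2)"
  using assms(1,4)
proof (induction S arbitrary: f rule: finite_induct)
  case empty
  then show ?case by simp
next
  case (insert e A)
  let ?E = "measure_pmf.expectation (bernoulli_product A p) :: _ \<Rightarrow> real"
  define F where "F b = (\<lambda>X. f (X(e := b)))" for b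
  define a where "a b = ?E (F b)" for b
  define q where "q b = ?E (\<lambda>X. (F b X)\<^sup>2)" for b
  have IH: "q b - (a b)\<^sup>2 \<le> (\<Sum>e\<in>A. (c e)\<^sup>2)" for b
    unfolding q_def a_def
  proof (rule insert.IH)
    fix X e' assume "e' \<in> A"
    then have "e' \<noteq> e" using insert.hyps by auto
    then have twist: "X(e' := v, e := b) = X(e := b, e' := v)" for v
      by (intro fun_upd_twist)
    show "\<bar>F b (X(e' := True)) - F b (X(e' := False))\<bar> \<le> c e'"
      unfolding F_def twist by (rule insert.prems) (use \<open>e' \<in> A\<close> in simp)
  qed
  have "\<bar>a True - a False\<bar> = \<bar>?E (\<lambda>X. F True X - F False X)\<bar>"
    using insert.hyps by (simp add: a_def)
  also have "\<dots> \<le> ?E (\<lambda>X. \<bar>F True X - F False X\<bar>)"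
    by (rule integral_abs_bound)
  also have "\<dots> \<le> ?E (\<lambda>X. c e)"
    unfolding F_def using insert.hyps by (intro integral_mono insert.prems) auto
  finally have diff: "(a True - a False)\<^sup>2 \<le> (c e)\<^sup>2"
    by (simp add: abs_le_square_iff[symmetric] abs_le_iff)
  have "p * (1 - p) * (a True - a False)\<^sup>2 \<le> 1 * (c e)\<^sup>2"
    by (rule mult_mono[OF _ diff]) (use p in \<open>auto simp: mult_le_one\<close>)
  moreover have "p * (q True - (a True)\<^sup>2) + (1 - p) * (q False - (a False)\<^sup>2)
      \<le> p * (\<Sum>e\<in>A. (c e)\<^sup>2) + (1 - p) * (\<Sum>e\<in>A. (c e)\<^sup>2)"
    using p by (intro add_mono mult_left_mono IH) auto
  moreover have "(p * q True + (1 - p) * q False) - (p * a True + (1 - p) * a False)\<^sup>2 =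
      (p * (q True - (a True)\<^sup>2) + (1 - p) * (q False - (a False)\<^sup>2)) +
      p * (1 - p) * (a True - a False)\<^sup>2"
    by (simp add: algebra_simps power2_eq_square)
  ultimately have "(p * q True + (1 - p) * q False) - (p * a True + (1 - p) * a False)\<^sup>2
      \<le> (\<Sum>e\<in>A. (c e)\<^sup>2) + (c e)\<^sup>2"
    by (simp add: algebra_simps)
  then show ?case
    using insert.hyps p by (simp add: expectation_insert q_def a_def F_def)
qed

lemma variance_complex_bernoulli:
  fixes f :: "('a \<Rightarrow> bool) \<Rightarrow> complex"
  assumes S: "finite S" and p: "0 \<le> p" "p \<le> 1"
    and osc: "\<And>X e. e \<in> S \<Longrightarrow> cmod (f (X(e := True)) - f (X(e := False))) \<le> c"
  defines "m \<equiv> measure_pmf.expectation (bernoulli_product S p) f"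
  shows "measure_pmf.expectation (bernoulli_product S p) (\<lambda>X. (cmod (f X - m))\<^sup>2)
     \<le> 2 * real (card S) * c\<^sup>2"
proof -
  let ?E = "measure_pmf.expectation (bernoulli_product S p)"
  have Re: "\<bar>Re (f (X(e := True))) - Re (f (X(e := False)))\<bar> \<le> c" if "e \<in> S" for X e
    using osc[OF that, of X] abs_Re_le_cmod[of "f (X(e := True)) - f (X(e := False))"] by simp
  have Im: "\<bar>Im (f (X(e := True))) - Im (f (X(e := False)))\<bar> \<le> c" if "e \<in> S" for X e
    using osc[OF that, of X] abs_Im_le_cmod[of "f (X(e := True)) - f (X(e := False))"] by simp
  have m: "Re m = ?E (\<lambda>X. Re (f X))" "Im m = ?E (\<lambda>X. Im (f X))"
    using S by (simp_all add: m_def)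
  have sq: "?E (\<lambda>X. (g X - ?E g)\<^sup>2) = ?E (\<lambda>X. (g X)\<^sup>2) - (?E g)\<^sup>2" for g :: "_ \<Rightarrow> real"
    using S by (intro measure_pmf.variance_eq) auto
  have "?E (\<lambda>X. (cmod (f X - m))\<^sup>2) = ?E (\<lambda>X. (Re (f X) - Re m)\<^sup>2) + ?E (\<lambda>X. (Im (f X) - Im m)\<^sup>2)"
    using S by (simp add: cmod_power2)
  also have "\<dots> \<le> (\<Sum>e\<in>S. c\<^sup>2) + (\<Sum>e\<in>S. c\<^sup>2)"
    unfolding m sq using S p Re Im by (intro add_mono efron_stein_bernoulli) auto
  finally show ?thesis by simp
qed

text \<open>
  Nonnegativity of the variance, in the form in which \<open>L1\<close> norms are bounded by \<open>L2\<close> norms.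
\<close>

lemma expectation_le_sqrt:
  fixes f :: "('a \<Rightarrow> bool) \<Rightarrow> real"
  assumes S: "finite S"
  shows "measure_pmf.expectation (bernoulli_product S p) f
     \<le> sqrt (measure_pmf.expectation (bernoulli_product S p) (\<lambda>X. (f X)\<^sup>2))"
proof -
  let ?E = "measure_pmf.expectation (bernoulli_product S p)"
  have "0 \<le> ?E (\<lambda>X. (f X - ?E f)\<^sup>2)" by simp
  also have "\<dots> = ?E (\<lambda>X. (f X)\<^sup>2) - (?E f)\<^sup>2"
    using S by (intro measure_pmf.variance_eq) auto
  finally show ?thesis by (intro real_le_rsqrt) simp
qed

lemma expectation_norm_le:
  fixes f :: "('a \<Rightarrow> bool) \<Rightarrow> 'b :: {banach, second_countable_topology}"
  assumes "finite S" "\<And>X. norm (f X) \<le> c"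
  shows "norm (measure_pmf.expectation (bernoulli_product S p) f) \<le> c"
proof -
  have "norm (measure_pmf.expectation (bernoulli_product S p) f)
      \<le> measure_pmf.expectation (bernoulli_product S p) (\<lambda>X. norm (f X))"
    by (rule integral_norm_bound)
  also have "\<dots> \<le> measure_pmf.expectation (bernoulli_product S p) (\<lambda>_. c)"
    using assms by (intro integral_mono) auto
  finally show ?thesis by simp
qed

section \<open>Resolvents on the imaginary axis\<close>

definition mat_trace :: "'a :: comm_monoid_add mat \<Rightarrow> 'a" where
  "mat_trace M = (\<Sum>k<dim_row M. M $$ (k, k))"

lemma mat_trace_mult_comm:
  fixes M N :: "'a :: comm_semiring_0 mat"
  assumes "M \<in> carrier_mat n m" "N \<in> carrier_mat m n"
  shows "mat_trace (M * N) = mat_trace (N * M)"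
proof -
  have "mat_trace (M * N) = (\<Sum>i<n. \<Sum>j<m. M $$ (i, j) * N $$ (j, i))"
    using assms by (auto simp: mat_trace_def scalar_prod_def atLeast0LessThan intro!: sum.cong)
  also have "\<dots> = (\<Sum>j<m. \<Sum>i<n. N $$ (j, i) * M $$ (i, j))"
    by (subst sum.swap) (simp add: mult.commute)
  also have "\<dots> = mat_trace (N * M)"
    using assms by (auto simp: mat_trace_def scalar_prod_def atLeast0LessThan intro!: sum.cong)
  finally show ?thesis .
qed

definition vec_l2 :: "complex vec \<Rightarrow> real" where
  "vec_l2 v = L2_set (\<lambda>k. cmod (v $ k)) {..<dim_vec v}"

lemma vec_l2_nonneg [simp]: "0 \<le> vec_l2 v"
  by (simp add: vec_l2_def L2_set_nonneg)

lemma cmod_le_vec_l2: "k < dim_vec v \<Longrightarrow> cmod (v $ k) \<le> vec_l2 v"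
  unfolding vec_l2_def by (rule member_le_L2_set) auto

lemma vec_l2_unit: "k < n \<Longrightarrow> vec_l2 (unit_vec n k) = 1"
  by (simp add: vec_l2_def L2_set_def unit_vec_def if_distrib[of "\<lambda>x. (cmod x)\<^sup>2"] cong: if_cong)

lemma vec_l2_ones: "vec_l2 (Matrix.vec n (\<lambda>_. 1)) = sqrt n"
  by (simp add: vec_l2_def L2_set_def)

text \<open>
  The matrix \<open>t * 1 + \<i> * s * A\<close>, that is, \<open>\<i>\<close> times \<open>s * A - z\<close> for the spectral
  parameter \<open>z = \<i> * t\<close>. This normalization makes the spectral traces below have
  nonnegative real parts.
\<close>

definition skew_shift :: "real \<Rightarrow> real \<Rightarrow> real mat \<Rightarrow> complex mat" where
  "skew_shift t s A = of_real t \<cdot>\<^sub>m 1\<^sub>m (dim_row A) + (\<i> * of_real s) \<cdot>\<^sub>m map_mat of_real A"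

lemma skew_shift_carrier [simp]: "A \<in> carrier_mat n n \<Longrightarrow> skew_shift t s A \<in> carrier_mat n n"
  by (auto simp: skew_shift_def)

definition sym_mat :: "nat \<Rightarrow> 'a mat \<Rightarrow> bool" where
  "sym_mat n A \<longleftrightarrow> A \<in> carrier_mat n n \<and> (\<forall>i<n. \<forall>j<n. A $$ (i, j) = A $$ (j, i))"

lemma sym_mat_carrier: "sym_mat n A \<Longrightarrow> A \<in> carrier_mat n n"
  by (simp add: sym_mat_def)

lemma sym_form_real:
  fixes A :: "real mat" and v :: "nat \<Rightarrow> complex"
  assumes "sym_mat n A"
  shows "Im (\<Sum>k<n. \<Sum>l<n. cnj (v k) * of_real (A $$ (k, l)) * v l) = 0"
proof -
  let ?q = "\<Sum>k<n. \<Sum>l<n. cnj (v k) * of_real (A $$ (k, l)) * v l"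
  have "cnj ?q = (\<Sum>k<n. \<Sum>l<n. v k * of_real (A $$ (k, l)) * cnj (v l))"
    by simp
  also have "\<dots> = (\<Sum>l<n. \<Sum>k<n. v k * of_real (A $$ (k, l)) * cnj (v l))"
    by (rule sum.swap)
  also have "\<dots> = ?q"
    using assms by (intro sum.cong refl) (auto simp: sym_mat_def mult_ac)
  finally have "cnj ?q = ?q" .
  from arg_cong[OF this, of Im] show ?thesis
    unfolding cnj.simps by linarith
qed

text \<open>
  For symmetric \<open>A\<close> the vectors \<open>t v\<close> and \<open>\<i> s A v\<close> are orthogonal for the real inner
  product, so the squared length of \<open>(t + \<i> s A) v\<close> is the sum of their squared lengths. This
  gives both invertibility and the bound \<open>1 / t\<close> for the inverse.
\<close>

lemma skew_shift_expands:
  assumes A: "sym_mat n A" and v: "v \<in> carrier_vec n" and t: "0 \<le> t"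
  shows "t * vec_l2 v \<le> vec_l2 (skew_shift t s A *\<^sub>v v)"
proof -
  define u where "u k = (\<Sum>l<n. of_real (A $$ (k, l)) * v $ l)" for k
  have A': "A \<in> carrier_mat n n" using A by (rule sym_mat_carrier)
  have entry: "(skew_shift t s A *\<^sub>v v) $ k = of_real t * v $ k + \<i> * of_real s * u k" if "k < n" for k
  proof -
    have "(skew_shift t s A *\<^sub>v v) $ k =
      (\<Sum>l<n. (of_real t * (if k = l then 1 else 0) + \<i> * of_real s * of_real (A $$ (k, l))) * v $ l)"
      using that A' v by (auto simp: skew_shift_def scalar_prod_def atLeast0LessThan intro!: sum.cong)
    also have "\<dots> = (\<Sum>l<n. if l = k then of_real t * v $ l else 0) + \<i> * of_real s * u k"
      unfolding u_def sum_distrib_left sum.distrib[symmetric]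
      by (intro sum.cong) (auto simp: algebra_simps)
    also have "\<dots> = of_real t * v $ k + \<i> * of_real s * u k"
      using that by simp
    finally show ?thesis .
  qed
  have pointwise: "(cmod (of_real t * x + \<i> * of_real s * y))\<^sup>2 =
      t\<^sup>2 * (cmod x)\<^sup>2 + s\<^sup>2 * (cmod y)\<^sup>2 - 2 * t * s * Im (cnj x * y)" for x y
    unfolding cmod_power2 by (simp add: algebra_simps power2_eq_square)
  have cross: "(\<Sum>k<n. Im (cnj (v $ k) * u k)) = 0"
    using sym_form_real[OF A, of "\<lambda>k. v $ k"]
    by (simp add: u_def sum_distrib_left mult.assoc)
  have "(\<Sum>k<n. (cmod ((skew_shift t s A *\<^sub>v v) $ k))\<^sup>2) =
     (\<Sum>k<n. t\<^sup>2 * (cmod (v $ k))\<^sup>2 + s\<^sup>2 * (cmod (u k))\<^sup>2 - 2 * t * s * Im (cnj (v $ k) * u k))"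
    by (intro sum.cong refl) (simp only: entry pointwise lessThan_iff)
  also have "\<dots> = t\<^sup>2 * (\<Sum>k<n. (cmod (v $ k))\<^sup>2) + s\<^sup>2 * (\<Sum>k<n. (cmod (u k))\<^sup>2)"
    using cross by (simp add: sum.distrib sum_subtractf flip: sum_distrib_left)
  also have "\<dots> \<ge> t\<^sup>2 * (\<Sum>k<n. (cmod (v $ k))\<^sup>2)"
    by (simp add: sum_nonneg)
  finally have "sqrt (t\<^sup>2 * (\<Sum>k<n. (cmod (v $ k))\<^sup>2)) \<le> sqrt (\<Sum>k<n. (cmod ((skew_shift t s A *\<^sub>v v) $ k))\<^sup>2)"
    by simp
  moreover have "dim_vec v = n" "dim_vec (skew_shift t s A *\<^sub>v v) = n"
    using v A' by (auto simp: skew_shift_def)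
  ultimately show ?thesis
    using t by (simp add: vec_l2_def L2_set_def real_sqrt_mult)
qed

lemma skew_shift_invertible:
  assumes A: "sym_mat n A" and t: "0 < t"
  shows "\<exists>W\<in>carrier_mat n n. skew_shift t s A * W = 1\<^sub>m n \<and> W * skew_shift t s A = 1\<^sub>m n"
proof -
  have A': "A \<in> carrier_mat n n" using A by (rule sym_mat_carrier)
  note M = skew_shift_carrier[OF A', of t s]
  have "det (skew_shift t s A) \<noteq> 0"
  proof
    assume "det (skew_shift t s A) = 0"
    then obtain v where v: "v \<in> carrier_vec n" "v \<noteq> 0\<^sub>v n" "skew_shift t s A *\<^sub>v v = 0\<^sub>v n"
      using det_0_iff_vec_prod_zero[OF M] by auto
    have "t * vec_l2 v \<le> vec_l2 (0\<^sub>v n)"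
      using skew_shift_expands[OF A v(1), of t s] t v(3) by simp
    also have "\<dots> = 0" by (simp add: vec_l2_def L2_set_def)
    finally have "vec_l2 v = 0" using t vec_l2_nonneg[of v] by (simp add: mult_le_0_iff)
    then have "v $ k = 0" if "k < n" for k
      using cmod_le_vec_l2[of k v] that v(1) by simp
    then have "v = 0\<^sub>v n" using v(1) by (intro eq_vecI) auto
    with v(2) show False by simp
  qed
  from det_non_zero_imp_unit[OF M this, of "()"] show ?thesis
    by (auto simp: Units_def ring_mat_simps)
qed

definition skew_resolvent :: "real \<Rightarrow> real \<Rightarrow> real mat \<Rightarrow> complex mat" where
  "skew_resolvent t s A = (SOME W. W \<in> carrier_mat (dim_row A) (dim_row A) \<and>
     skew_shift t s A * W = 1\<^sub>m (dim_row A) \<and> W * skew_shift t s A = 1\<^sub>m (dim_row A))"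

lemma skew_resolvent:
  assumes A: "sym_mat n A" and t: "0 < t"
  shows "skew_resolvent t s A \<in> carrier_mat n n"
    and "skew_shift t s A * skew_resolvent t s A = 1\<^sub>m n"
    and "skew_resolvent t s A * skew_shift t s A = 1\<^sub>m n"
proof -
  have n: "dim_row A = n" using A by (auto simp: sym_mat_def)
  have "\<exists>W. W \<in> carrier_mat n n \<and> skew_shift t s A * W = 1\<^sub>m n \<and> W * skew_shift t s A = 1\<^sub>m n"
    using skew_shift_invertible[OF assms, of s] by blast
  from someI_ex[OF this]
  have "skew_resolvent t s A \<in> carrier_mat n n \<and>
     skew_shift t s A * skew_resolvent t s A = 1\<^sub>m n \<and> skew_resolvent t s A * skew_shift t s A = 1\<^sub>m n"
    unfolding skew_resolvent_def n .
  then show "skew_resolvent t s A \<in> carrier_mat n n"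
    and "skew_shift t s A * skew_resolvent t s A = 1\<^sub>m n"
    and "skew_resolvent t s A * skew_shift t s A = 1\<^sub>m n" by auto
qed

lemma skew_resolvent_contracts:
  assumes A: "sym_mat n A" and t: "0 < t" and v: "v \<in> carrier_vec n"
  shows "vec_l2 (skew_resolvent t s A *\<^sub>v v) \<le> vec_l2 v / t"
proof -
  note W = skew_resolvent[OF A t, of s]
  have M: "skew_shift t s A \<in> carrier_mat n n"
    using A by (simp add: sym_mat_carrier)
  have "skew_shift t s A *\<^sub>v (skew_resolvent t s A *\<^sub>v v) = v"
    using W M v by (simp flip: assoc_mult_mat_vec)
  moreover have "t * vec_l2 (skew_resolvent t s A *\<^sub>v v)
      \<le> vec_l2 (skew_shift t s A *\<^sub>v (skew_resolvent t s A *\<^sub>v v))"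
    using W v t by (intro skew_shift_expands[OF A]) auto
  ultimately show ?thesis using t by (simp add: field_simps)
qed

lemma mat_mult_unit_vec:
  fixes M :: "'a :: comm_semiring_1 mat"
  assumes "M \<in> carrier_mat n n" "b < n"
  shows "M *\<^sub>v unit_vec n b = col M b"
  using assms by (intro eq_vecI) (auto simp: scalar_prod_def unit_vec_def if_distrib cong: if_cong)

lemma skew_resolvent_col:
  assumes A: "sym_mat n A" and t: "0 < t" and b: "b < n"
  shows "vec_l2 (col (skew_resolvent t s A) b) \<le> 1 / t"
  using skew_resolvent_contracts[OF A t, of "unit_vec n b" s] skew_resolvent(1)[OF A t, of s] b
  by (simp add: mat_mult_unit_vec vec_l2_unit)

lemma skew_resolvent_entry:
  assumes A: "sym_mat n A" and t: "0 < t" and ab: "a < n" "b < n"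
  shows "cmod (skew_resolvent t s A $$ (a, b)) \<le> 1 / t"
proof -
  have "cmod (col (skew_resolvent t s A) b $ a) \<le> vec_l2 (col (skew_resolvent t s A) b)"
    using skew_resolvent(1)[OF A t, of s] ab by (intro cmod_le_vec_l2) auto
  also have "\<dots> \<le> 1 / t" by (rule skew_resolvent_col[OF A t ab(2)])
  finally show ?thesis using skew_resolvent(1)[OF A t, of s] ab by simp
qed

lemma skew_resolvent_frobenius:
  assumes A: "sym_mat n A" and t: "0 < t"
  shows "(\<Sum>a<n. \<Sum>b<n. (cmod (skew_resolvent t s A $$ (a, b)))\<^sup>2) \<le> real n / t\<^sup>2"
proof -
  note W = skew_resolvent(1)[OF A t, of s]
  have "(\<Sum>a<n. (cmod (skew_resolvent t s A $$ (a, b)))\<^sup>2) \<le> 1 / t\<^sup>2" if "b < n" for b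
  proof -
    have "(\<Sum>a<n. (cmod (skew_resolvent t s A $$ (a, b)))\<^sup>2) = (vec_l2 (col (skew_resolvent t s A) b))\<^sup>2"
      using W that by (auto simp: vec_l2_def L2_set_def sum_nonneg intro!: sum.cong)
    also have "\<dots> \<le> (1 / t)\<^sup>2"
      by (intro power_mono skew_resolvent_col[OF A t that]) auto
    finally show ?thesis by (simp add: power_divide)
  qed
  then have "(\<Sum>b<n. \<Sum>a<n. (cmod (skew_resolvent t s A $$ (a, b)))\<^sup>2) \<le> (\<Sum>b<n. 1 / t\<^sup>2)"
    by (intro sum_mono) auto
  then show ?thesis by (subst sum.swap) simp
qed

text \<open>
  The sum of all entries is the quadratic form of the resolvent at the all-ones vector, whose squared
  length is \<open>n\<close>; bounding the entries one by one would lose a factor \<open>n\<close>.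
\<close>

lemma skew_resolvent_total:
  assumes A: "sym_mat n A" and t: "0 < t"
  shows "cmod (\<Sum>a<n. \<Sum>b<n. skew_resolvent t s A $$ (a, b)) \<le> real n / t"
proof -
  note W = skew_resolvent(1)[OF A t, of s]
  define one where "one = Matrix.vec n (\<lambda>_. 1 :: complex)"
  define u where "u = skew_resolvent t s A *\<^sub>v one"
  have u: "u $ a = (\<Sum>b<n. skew_resolvent t s A $$ (a, b))" "dim_vec u = n" if "a < n" for a
    using W that by (auto simp: u_def one_def scalar_prod_def atLeast0LessThan)
  have "cmod (\<Sum>a<n. \<Sum>b<n. skew_resolvent t s A $$ (a, b)) = cmod (\<Sum>a<n. u $ a)"
    using u by simp
  also have "\<dots> \<le> (\<Sum>a<n. cmod (u $ a))"
    by (rule norm_sum)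
  also have "\<dots> = (\<Sum>a<n. \<bar>1\<bar> * \<bar>cmod (u $ a)\<bar>)" by simp
  also have "\<dots> \<le> L2_set (\<lambda>_. 1) {..<n} * L2_set (\<lambda>a. cmod (u $ a)) {..<n}"
    by (rule L2_set_mult_ineq)
  also have "\<dots> = sqrt n * vec_l2 u"
    using W by (simp add: vec_l2_def L2_set_def u_def)
  also have "\<dots> \<le> sqrt n * (vec_l2 one / t)"
    unfolding u_def by (intro mult_left_mono skew_resolvent_contracts[OF A t]) (auto simp: one_def)
  also have "\<dots> = real n / t" by (simp add: one_def vec_l2_ones)
  finally show ?thesis .
qed

lemma skew_resolvent_mult_entry:
  assumes A: "sym_mat n A" and B: "sym_mat n B" and t: "0 < t" and ab: "a < n" "b < n"
  shows "cmod ((skew_resolvent t s A * skew_resolvent t s B) $$ (a, b)) \<le> 1 / t\<^sup>2"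
proof -
  note WA = skew_resolvent(1)[OF A t, of s] and WB = skew_resolvent(1)[OF B t, of s]
  let ?v = "skew_resolvent t s A *\<^sub>v col (skew_resolvent t s B) b"
  have "(skew_resolvent t s A * skew_resolvent t s B) $$ (a, b) = ?v $ a"
    using WA WB ab by simp
  also have "cmod \<dots> \<le> vec_l2 ?v"
    using WA ab by (intro cmod_le_vec_l2) auto
  also have "\<dots> \<le> vec_l2 (col (skew_resolvent t s B) b) / t"
    using WB ab by (intro skew_resolvent_contracts[OF A t]) auto
  also have "\<dots> \<le> (1 / t) / t"
    using t by (intro divide_right_mono skew_resolvent_col[OF B t ab(2)]) auto
  finally show ?thesis by (simp add: power2_eq_square)
qed

lemma resolvent_identity:
  assumes A: "sym_mat n A" and B: "sym_mat n B" and t: "0 < t"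
  shows "skew_resolvent t s A - skew_resolvent t s B =
     skew_resolvent t s A * ((\<i> * of_real s) \<cdot>\<^sub>m map_mat of_real (B - A)) * skew_resolvent t s B"
proof -
  define MA MB WA WB where "MA = skew_shift t s A" and "MB = skew_shift t s B"
    and "WA = skew_resolvent t s A" and "WB = skew_resolvent t s B"
  have A': "A \<in> carrier_mat n n" and B': "B \<in> carrier_mat n n"
    using A B by (auto simp: sym_mat_def)
  have c [simp]: "MA \<in> carrier_mat n n" "MB \<in> carrier_mat n n" "WA \<in> carrier_mat n n" "WB \<in> carrier_mat n n"
    using A' B' skew_resolvent(1)[OF A t] skew_resolvent(1)[OF B t]
    by (auto simp: MA_def MB_def WA_def WB_def)
  have inv: "WA * MA = 1\<^sub>m n" "MB * WB = 1\<^sub>m n"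
    using skew_resolvent[OF A t, of s] skew_resolvent[OF B t, of s]
    by (auto simp: MA_def MB_def WA_def WB_def)
  have "(\<i> * of_real s) \<cdot>\<^sub>m map_mat of_real (B - A) = MB - MA"
    using A' B' by (intro eq_matI) (auto simp: MA_def MB_def skew_shift_def algebra_simps)
  then have "WA * ((\<i> * of_real s) \<cdot>\<^sub>m map_mat of_real (B - A)) * WB = WA * (MB - MA) * WB"
    by simp
  also have "\<dots> = (WA * MB - WA * MA) * WB"
    by (simp add: mult_minus_distrib_mat[of _ n n _ n])
  also have "\<dots> = WA * MB * WB - WA * MA * WB"
    by (rule minus_mult_distrib_mat[of _ n n _ _ n]) (auto intro: mult_carrier_mat[of _ n n])
  also have "WA * MB * WB = WA * (MB * WB)"
    by (rule assoc_mult_mat) (rule c)+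
  finally show ?thesis
    using inv c by (simp add: WA_def WB_def)
qed

section \<open>The spectrum of a real symmetric matrix\<close>

lemma mult_mat_entry:
  assumes "M \<in> carrier_mat n n" "N \<in> carrier_mat n n" "i < n" "j < n"
  shows "(M * N) $$ (i, j) = (\<Sum>l<n. M $$ (i, l) * N $$ (l, j))"
  using assms by (auto simp: scalar_prod_def atLeast0LessThan intro!: sum.cong)

text \<open>
  Back substitution: going up from the last row, the entries of \<open>V\<close> below the diagonal vanish,
  because each is the only surviving term of an entry of \<open>U * V\<close>.
\<close>

lemma upper_triangular_right_inverse:
  fixes U V :: "'a :: field mat"
  assumes U: "U \<in> carrier_mat n n" "upper_triangular U" and V: "V \<in> carrier_mat n n"
    and UV: "U * V = 1\<^sub>m n" and nz: "\<And>k. k < n \<Longrightarrow> U $$ (k, k) \<noteq> 0"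
  shows "k < n \<Longrightarrow> V $$ (k, k) = 1 / U $$ (k, k)"
proof -
  have row: "(U * V) $$ (i, j) = U $$ (i, i) * V $$ (i, j)"
    if "i < n" "j < n" "\<And>l. i < l \<Longrightarrow> l < n \<Longrightarrow> V $$ (l, j) = 0" for i j
  proof -
    have "(U * V) $$ (i, j) = (\<Sum>l<n. U $$ (i, l) * V $$ (l, j))"
      using U V that by (intro mult_mat_entry)
    also have "\<dots> = (\<Sum>l<n. if l = i then U $$ (i, i) * V $$ (i, j) else 0)"
    proof (intro sum.cong refl)
      fix l assume "l \<in> {..<n}"
      then show "U $$ (i, l) * V $$ (l, j) = (if l = i then U $$ (i, i) * V $$ (i, j) else 0)"
        using that U upper_triangularD[OF U(2), of l i] by (cases l i rule: linorder_cases) auto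
    qed
    finally show ?thesis using that by simp
  qed
  have below: "V $$ (i, j) = 0" if "j < i" "i < n" for i j
    using that
  proof (induction "n - i" arbitrary: i rule: less_induct)
    case less
    have "(U * V) $$ (i, j) = U $$ (i, i) * V $$ (i, j)"
      by (rule row) (use less in auto)
    moreover have "(U * V) $$ (i, j) = 0"
      using UV less.prems by simp
    ultimately show ?case using nz less.prems by simp
  qed
  assume "k < n"
  have "U $$ (k, k) * V $$ (k, k) = (U * V) $$ (k, k)"
    by (rule row[symmetric]) (use \<open>k < n\<close> below in auto)
  also have "\<dots> = 1" using UV \<open>k < n\<close> by simp
  finally show ?thesis using nz \<open>k < n\<close> by (simp add: field_simps)
qed

lemma sym_mat_eigenvalue_real:
  assumes A: "sym_mat n A" and root: "poly (char_poly (map_mat complex_of_real A)) e = 0"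
  shows "Im e = 0"
proof -
  have A': "A \<in> carrier_mat n n" using A by (rule sym_mat_carrier)
  then have "eigenvalue (map_mat complex_of_real A) e"
    using root by (subst eigenvalue_root_char_poly[of _ n]) auto
  then obtain v where v: "v \<in> carrier_vec n" "v \<noteq> 0\<^sub>v n" "map_mat complex_of_real A *\<^sub>v v = e \<cdot>\<^sub>v v"
    using A' by (auto simp: eigenvalue_def eigenvector_def)
  have eig: "(\<Sum>l<n. complex_of_real (A $$ (k, l)) * v $ l) = e * v $ k" if "k < n" for k
  proof -
    have "(map_mat complex_of_real A *\<^sub>v v) $ k = (\<Sum>l<n. complex_of_real (A $$ (k, l)) * v $ l)"
      using that A' v(1) by (auto simp: scalar_prod_def atLeast0LessThan intro!: sum.cong)
    then show ?thesis using v that by simp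
  qed
  have "(\<Sum>k<n. \<Sum>l<n. cnj (v $ k) * of_real (A $$ (k, l)) * v $ l) =
      (\<Sum>k<n. cnj (v $ k) * (e * v $ k))"
    by (intro sum.cong refl) (simp add: mult.assoc eig flip: sum_distrib_left)
  also have "\<dots> = (\<Sum>k<n. e * of_real ((cmod (v $ k))\<^sup>2))"
    by (intro sum.cong refl) (simp only: complex_norm_square, simp add: mult_ac)
  also have "\<dots> = e * of_real (\<Sum>k<n. (cmod (v $ k))\<^sup>2)"
    by (simp flip: sum_distrib_left)
  finally have "Im e * (\<Sum>k<n. (cmod (v $ k))\<^sup>2) = 0"
    using sym_form_real[OF A, of "\<lambda>k. v $ k"] by simp
  moreover have "(\<Sum>k<n. (cmod (v $ k))\<^sup>2) \<noteq> 0"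
  proof
    assume "(\<Sum>k<n. (cmod (v $ k))\<^sup>2) = 0"
    then have "v $ k = 0" if "k < n" for k
      using that by (subst (asm) sum_nonneg_eq_0_iff) auto
    then show False using v(1,2) by (auto intro!: eq_vecI)
  qed
  ultimately show ?thesis by simp
qed

text \<open>
  Compares the values of two real polynomials at real points, which are determined by the complex
  factorization.
\<close>

lemma proots_of_complex_factorization:
  fixes q :: "real poly"
  assumes "map_poly complex_of_real q = (\<Prod>r\<leftarrow>rs. [:- complex_of_real r, 1:])"
  shows "proots q = mset rs"
proof -
  have "poly q x = poly (\<Prod>r\<leftarrow>rs. [:- r, 1:]) x" for x
  proof -
    have "complex_of_real (poly q x) = poly (map_poly complex_of_real q) (of_real x)"
      by (simp add: of_real_hom.poly_map_poly)
    also have "\<dots> = complex_of_real (poly (\<Prod>r\<leftarrow>rs. [:- r, 1:]) x)"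
      unfolding assms by (induction rs) auto
    finally show ?thesis by (simp only: of_real_eq_iff)
  qed
  then have "q = (\<Prod>r\<leftarrow>rs. [:- r, 1:])"
    by (intro poly_ext)
  moreover have "proots (\<Prod>r\<leftarrow>rs. [:- r, 1:]) = mset rs"
  proof (induction rs)
    case (Cons r rs)
    have "(\<Prod>r\<leftarrow>rs. [:- r, 1:]) \<noteq> 0" by (auto simp: prod_list_zero_iff)
    then show ?case using Cons by (simp add: proots_mult del: mult_pCons_left)
  qed simp
  ultimately show ?thesis by simp
qed

text \<open>
  A Schur triangularization of the complexified matrix has the eigenvalues on its diagonal, and the
  traces of the square and of all resolvents can be read off from this diagonal. The
  eigenvalues are real by the usual quadratic form argument, so they are also the roots of the real
  characteristic polynomial.
\<close>

theorem sym_mat_spectrum: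
  fixes A :: "real mat"
  assumes A: "sym_mat n A"
  obtains rs where "length rs = n" "proots (char_poly A) = mset rs"
    "(\<Sum>r\<leftarrow>rs. r\<^sup>2) = (\<Sum>i<n. \<Sum>j<n. (A $$ (i, j))\<^sup>2)"
    "\<And>t s. 0 < t \<Longrightarrow> mat_trace (skew_resolvent t s A) = (\<Sum>r\<leftarrow>rs. 1 / (of_real t + \<i> * of_real (s * r)))"
proof -
  define C where "C = map_mat complex_of_real A"
  have A': "A \<in> carrier_mat n n" using A by (rule sym_mat_carrier)
  then have C: "C \<in> carrier_mat n n" by (simp add: C_def)
  obtain es where es: "char_poly C = (\<Prod>e\<leftarrow>es. [:- e, 1:])" "length es = n"
    using char_poly_factorized[OF C] by auto
  have "Im e = 0" if "e \<in> set es" for e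
    using A that es(1)[unfolded C_def]
    by (intro sym_mat_eigenvalue_real[of n A]) (auto simp: poly_prod_list prod_list_zero_iff)
  then have es_Re: "es = map (\<lambda>e. complex_of_real (Re e)) es"
    by (intro map_idI[symmetric]) (simp add: complex_eq_iff)
  define rs where "rs = map Re es"
  have rs: "es = map complex_of_real rs"
    unfolding rs_def map_map o_def by (rule es_Re)
  have 2: "proots (char_poly A) = mset rs"
  proof (rule proots_of_complex_factorization)
    show "map_poly complex_of_real (char_poly A) = (\<Prod>r\<leftarrow>rs. [:- complex_of_real r, 1:])"
      using es(1) by (simp add: C_def rs o_def of_real_hom.char_poly_hom[OF A'])
  qed
  obtain B P Q where "schur_decomposition C es = (B, P, Q)"
    by (cases "schur_decomposition C es") auto
  from schur_decomposition[OF C es(1) this]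
  have sim: "similar_mat_wit C B P Q" and B: "upper_triangular B" "diag_mat B = es" by auto
  note wit = similar_mat_witD2[OF C sim]
  note [simp] = wit(5-7) carrier_matD[OF wit(5)]
  have mult_closed [simp]: "M * N \<in> carrier_mat n n"
    if "M \<in> carrier_mat n n" "N \<in> carrier_mat n n" for M N :: "complex mat"
    using that by (rule mult_carrier_mat)
  have assoc: "M * N * K = M * (N * K)"
    if "M \<in> carrier_mat n n" "N \<in> carrier_mat n n" "K \<in> carrier_mat n n" for M N K :: "complex mat"
    using that by (rule assoc_mult_mat)
  have [simp]: "M * 1\<^sub>m n = M" "1\<^sub>m n * M = M" if "M \<in> carrier_mat n n" for M :: "complex mat"
    using that by auto
  have PQ: "P * (Q * M) = M" if "M \<in> carrier_mat n n" for M
    using that wit(1) by (simp flip: assoc)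
  have QP: "Q * (P * M) = M" if "M \<in> carrier_mat n n" for M
    using that wit(2) by (simp flip: assoc)
  have diag: "B $$ (k, k) = of_real (rs ! k)" if "k < n" for k
    using arg_cong[OF B(2), of "\<lambda>xs. xs ! k"] that es(2) carrier_matD(1)[OF wit(5)]
    by (simp add: rs diag_mat_def)
  have len: "length rs = n" using es(2) rs by simp
  have conj_trace: "mat_trace (Q * M * P) = mat_trace M" if M: "M \<in> carrier_mat n n" for M
  proof -
    have "mat_trace (Q * M * P) = mat_trace (P * (Q * M))"
      using M by (intro mat_trace_mult_comm[of _ n n]) auto
    then show ?thesis using M by (simp add: PQ)
  qed
  have 3: "(\<Sum>r\<leftarrow>rs. r\<^sup>2) = (\<Sum>i<n. \<Sum>j<n. (A $$ (i, j))\<^sup>2)"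
  proof -
    have "Q * (C * C) * P = B * B"
      unfolding wit(3) using wit(2) by (simp add: assoc QP)
    then have "mat_trace (C * C) = mat_trace (B * B)"
      using conj_trace[of "C * C"] C by simp
    also have "\<dots> = (\<Sum>k<n. (B $$ (k, k))\<^sup>2)"
      unfolding mat_trace_def
    proof (intro sum.cong)
      fix k assume "k \<in> {..<n}"
      then have k: "k < n" by simp
      have "(B * B) $$ (k, k) = (\<Sum>l<n. B $$ (k, l) * B $$ (l, k))"
        using k by (intro mult_mat_entry) auto
      also have "\<dots> = (\<Sum>l<n. if l = k then (B $$ (k, k))\<^sup>2 else 0)"
      proof (intro sum.cong refl)
        fix l assume "l \<in> {..<n}"
        then show "B $$ (k, l) * B $$ (l, k) = (if l = k then (B $$ (k, k))\<^sup>2 else 0)"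
          using k upper_triangularD[OF B(1), of l k] upper_triangularD[OF B(1), of k l] wit(5)
          by (cases l k rule: linorder_cases) (auto simp: power2_eq_square)
      qed
      finally show "(B * B) $$ (k, k) = (B $$ (k, k))\<^sup>2" using k by simp
    qed auto
    also have "\<dots> = of_real (\<Sum>k<n. (rs ! k)\<^sup>2)"
      by (simp add: diag)
    also have "(\<Sum>k<n. (rs ! k)\<^sup>2) = (\<Sum>r\<leftarrow>rs. r\<^sup>2)"
      by (simp add: sum_list_sum_nth len atLeast0LessThan)
    finally have "mat_trace (C * C) = of_real (\<Sum>r\<leftarrow>rs. r\<^sup>2)" .
    moreover have "mat_trace (C * C) = of_real (\<Sum>i<n. \<Sum>j<n. (A $$ (i, j))\<^sup>2)"
    proof -
      have "mat_trace (C * C) = (\<Sum>i<n. \<Sum>j<n. C $$ (i, j) * C $$ (j, i))"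
        unfolding mat_trace_def using C by (intro sum.cong mult_mat_entry) auto
      also have "\<dots> = of_real (\<Sum>i<n. \<Sum>j<n. (A $$ (i, j))\<^sup>2)"
        using A' A by (auto simp: C_def sym_mat_def power2_eq_square intro!: sum.cong)
      finally show ?thesis .
    qed
    ultimately show ?thesis by (simp only: of_real_eq_iff)
  qed
  have 4: "mat_trace (skew_resolvent t s A) = (\<Sum>r\<leftarrow>rs. 1 / (of_real t + \<i> * of_real (s * r)))"
    if t: "0 < t" for t s
  proof -
    define W where "W = skew_resolvent t s A"
    define U where "U = complex_of_real t \<cdot>\<^sub>m 1\<^sub>m n + (\<i> * of_real s) \<cdot>\<^sub>m B"
    define V where "V = Q * W * P"
    have W: "W \<in> carrier_mat n n" "skew_shift t s A * W = 1\<^sub>m n"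
      using skew_resolvent[OF A t] by (auto simp: W_def)
    have M: "skew_shift t s A = complex_of_real t \<cdot>\<^sub>m 1\<^sub>m n + (\<i> * of_real s) \<cdot>\<^sub>m C"
      using A' by (auto simp: skew_shift_def C_def)
    have U: "U \<in> carrier_mat n n" and V: "V \<in> carrier_mat n n"
      using W by (auto simp: U_def V_def)
    have PU: "skew_shift t s A * P = P * U"
    proof -
      have CP: "C * P = P * B"
        unfolding wit(3) using wit(2) by (simp add: assoc)
      have "skew_shift t s A * P = complex_of_real t \<cdot>\<^sub>m P + (\<i> * of_real s) \<cdot>\<^sub>m (C * P)"
        unfolding M using C by (subst add_mult_distrib_mat[of _ n n _ _ n]) (auto simp: mult_smult_assoc_mat[of _ n n _ n])
      also have "\<dots> = P * U"
        unfolding U_def CP by (subst mult_add_distrib_mat[of _ n n _ n]) (auto simp: mult_smult_distrib[of _ n n _ n])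
      finally show ?thesis .
    qed
    have "U * V = 1\<^sub>m n"
    proof -
      have "P * (U * V) = (P * U) * V"
        using U V by (simp add: assoc)
      also have "\<dots> = skew_shift t s A * P * (Q * W * P)"
        by (simp add: PU V_def)
      also have "\<dots> = skew_shift t s A * W * P"
        using W(1) A' by (simp add: assoc PQ)
      also have "\<dots> = P" using W by simp
      finally have "Q * (P * (U * V)) = Q * P" by simp
      then show ?thesis using U V wit(2) by (simp add: QP)
    qed
    moreover have "upper_triangular U"
      using U upper_triangularD[OF B(1)] by (auto simp: U_def intro!: upper_triangularI)
    moreover have Uk: "U $$ (k, k) = of_real t + \<i> * of_real (s * rs ! k)" if "k < n" for k
      using that wit(5) by (simp add: U_def diag)
    moreover have "complex_of_real t + \<i> * of_real x \<noteq> 0" for x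
      using t by (simp add: complex_eq_iff)
    ultimately have "V $$ (k, k) = 1 / (of_real t + \<i> * of_real (s * rs ! k))" if "k < n" for k
      using upper_triangular_right_inverse[OF U _ V] that by metis
    then have "mat_trace V = (\<Sum>k<n. 1 / (of_real t + \<i> * of_real (s * rs ! k)))"
      using V by (simp add: mat_trace_def)
    also have "\<dots> = (\<Sum>r\<leftarrow>rs. 1 / (of_real t + \<i> * of_real (s * r)))"
      by (simp add: sum_list_sum_nth len atLeast0LessThan)
    finally show ?thesis
      using conj_trace[OF W(1)] by (simp add: V_def W_def)
  qed
  show ?thesis by (rule that[OF len 2 3 4])
qed

section \<open>From resolvent traces to absolute values\<close>

lemma arctan_le_self: "0 \<le> y \<Longrightarrow> arctan y \<le> y" for y :: real
proof -
  assume "0 \<le> y"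
  define g where "g z = z - arctan z" for z :: real
  have "g 0 \<le> g y"
  proof (rule DERIV_nonneg_imp_nondecreasing[OF \<open>0 \<le> y\<close>])
    fix z :: real
    have "(g has_real_derivative (1 - inverse (1 + z\<^sup>2))) (at z)"
      unfolding g_def by (auto intro!: derivative_eq_intros)
    moreover have "inverse (1 + z\<^sup>2) \<le> 1" by (intro inverse_le_1_iff[THEN iffD2]) auto
    ultimately show "\<exists>y. (g has_real_derivative y) (at z) \<and> 0 \<le> y" by (intro exI conjI) auto
  qed
  then show ?thesis by (simp add: g_def)
qed

lemma Re_inverse_skew: "0 < t \<Longrightarrow> Re (1 / (of_real t + \<i> * of_real x)) = t / (t\<^sup>2 + x\<^sup>2)"
  by (simp add: Re_divide power2_eq_square)

text \<open>
  The integrand is \<open>x\<^sup>2 / (t\<^sup>2 + x\<^sup>2)\<close>, with primitive \<open>\<bar>x\<bar> * arctan (t / \<bar>x\<bar>)\<close>. Over all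
  \<open>t > 0\<close> its integral would be \<open>pi / 2 * \<bar>x\<bar>\<close>; the pieces below \<open>d\<close> and above \<open>T\<close> are
  estimated by \<open>arctan y \<le> y\<close>.
\<close>

lemma abs_poisson_integral:
  fixes x :: real
  assumes d: "0 < d" "d \<le> T"
  obtains I where "((\<lambda>t. 1 - t * Re (1 / (of_real t + \<i> * of_real x))) has_integral I) {d..T}"
    "\<bar>pi / 2 * \<bar>x\<bar> - I\<bar> \<le> d + x\<^sup>2 / T"
proof (cases "x = 0")
  case True
  have "((\<lambda>t::real. 0 :: real) has_integral 0) {d..T}" by simp
  then have "((\<lambda>t. 1 - t * Re (1 / (of_real t + \<i> * of_real x))) has_integral 0) {d..T}"
    by (rule has_integral_eq[rotated]) (use d True in \<open>auto simp: Re_inverse_skew power2_eq_square\<close>)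
  then show ?thesis by (rule that) (use True d in auto)
next
  case False
  define F where "F t = \<bar>x\<bar> * arctan (t / \<bar>x\<bar>)" for t
  define I where "I = F T - F d"
  have "((\<lambda>t. x\<^sup>2 / (t\<^sup>2 + x\<^sup>2)) has_integral I) {d..T}"
    unfolding I_def
  proof (rule fundamental_theorem_of_calculus[OF d(2)])
    fix t assume "t \<in> {d..T}"
    define a where "a = \<bar>x\<bar>"
    have a: "0 < a" "x\<^sup>2 = a\<^sup>2" "F = (\<lambda>t. a * arctan (t / a))"
      using False by (auto simp: a_def F_def)
    have "(F has_real_derivative a * (inverse (1 + (t / a)\<^sup>2) * (1 / a))) (at t)"
      unfolding a(3) by (rule derivative_eq_intros refl)+ (use a(1) in auto)
    also have "a * (inverse (1 + (t / a)\<^sup>2) * (1 / a)) = inverse ((a\<^sup>2 + t\<^sup>2) / a\<^sup>2)"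
      using a(1) by (simp add: add_divide_distrib power_divide)
    also have "\<dots> = x\<^sup>2 / (t\<^sup>2 + x\<^sup>2)"
      by (simp add: a(2) add.commute)
    finally show "(F has_vector_derivative x\<^sup>2 / (t\<^sup>2 + x\<^sup>2)) (at t within {d..T})"
      unfolding has_real_derivative_iff_has_vector_derivative by (rule has_vector_derivative_at_within)
  qed
  then have "((\<lambda>t. 1 - t * Re (1 / (of_real t + \<i> * of_real x))) has_integral I) {d..T}"
  proof (rule has_integral_eq[rotated])
    fix t assume "t \<in> {d..T}"
    then have t: "0 < t" using d by simp
    then have "t\<^sup>2 + x\<^sup>2 \<noteq> 0" by (simp add: sum_power2_eq_zero_iff)
    then have "1 - t * (t / (t\<^sup>2 + x\<^sup>2)) = ((t\<^sup>2 + x\<^sup>2) - t\<^sup>2) / (t\<^sup>2 + x\<^sup>2)"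
      unfolding diff_divide_distrib by (simp add: power2_eq_square)
    then show "x\<^sup>2 / (t\<^sup>2 + x\<^sup>2) = 1 - t * Re (1 / (of_real t + \<i> * of_real x))"
      using t by (simp add: Re_inverse_skew)
  qed
  moreover have "\<bar>pi / 2 * \<bar>x\<bar> - I\<bar> \<le> d + x\<^sup>2 / T"
  proof -
    have T: "0 < T" using d by simp
    have "arctan (\<bar>x\<bar> / T) = pi / 2 - arctan (T / \<bar>x\<bar>)"
      using arctan_inverse[of "T / \<bar>x\<bar>"] False T by (simp add: sgn_if)
    moreover have "pi / 2 * \<bar>x\<bar> - I = \<bar>x\<bar> * (pi / 2 - arctan (T / \<bar>x\<bar>)) + \<bar>x\<bar> * arctan (d / \<bar>x\<bar>)"
      by (simp add: I_def F_def algebra_simps)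
    ultimately have "pi / 2 * \<bar>x\<bar> - I = \<bar>x\<bar> * arctan (\<bar>x\<bar> / T) + \<bar>x\<bar> * arctan (d / \<bar>x\<bar>)"
      by (simp only:)
    moreover have "\<bar>x\<bar> * arctan (\<bar>x\<bar> / T) \<le> \<bar>x\<bar> * (\<bar>x\<bar> / T)"
      using T by (intro mult_left_mono arctan_le_self) auto
    moreover have "\<bar>x\<bar> * arctan (d / \<bar>x\<bar>) \<le> \<bar>x\<bar> * (d / \<bar>x\<bar>)"
      using d by (intro mult_left_mono arctan_le_self) auto
    moreover have "0 \<le> \<bar>x\<bar> * arctan (\<bar>x\<bar> / T)" "0 \<le> \<bar>x\<bar> * arctan (d / \<bar>x\<bar>)"
      using T d by (auto simp: zero_le_arctan_iff)
    ultimately show ?thesis using False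
      by (simp add: power2_eq_square abs_mult_self_eq)
  qed
  ultimately show ?thesis by (rule that)
qed

lemma sum_abs_poisson_integral:
  fixes xs :: "real list"
  assumes d: "0 < d" "d \<le> T"
  shows "\<exists>I. ((\<lambda>t. real (length xs) - t * Re (\<Sum>x\<leftarrow>xs. 1 / (of_real t + \<i> * of_real x))) has_integral I) {d..T} \<and>
    \<bar>pi / 2 * (\<Sum>x\<leftarrow>xs. \<bar>x\<bar>) - I\<bar> \<le> real (length xs) * d + (\<Sum>x\<leftarrow>xs. x\<^sup>2) / T"
proof (induction xs)
  case (Cons x xs)
  then obtain I where I: "((\<lambda>t. real (length xs) - t * Re (\<Sum>x\<leftarrow>xs. 1 / (of_real t + \<i> * of_real x))) has_integral I) {d..T}"
    "\<bar>pi / 2 * (\<Sum>x\<leftarrow>xs. \<bar>x\<bar>) - I\<bar> \<le> real (length xs) * d + (\<Sum>x\<leftarrow>xs. x\<^sup>2) / T" by auto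
  obtain J where J: "((\<lambda>t. 1 - t * Re (1 / (of_real t + \<i> * of_real x))) has_integral J) {d..T}"
    "\<bar>pi / 2 * \<bar>x\<bar> - J\<bar> \<le> d + x\<^sup>2 / T"
    using abs_poisson_integral[OF d] by blast
  have "((\<lambda>t. real (length (x # xs)) - t * Re (\<Sum>x\<leftarrow>x # xs. 1 / (of_real t + \<i> * of_real x))) has_integral (J + I)) {d..T}"
    by (rule has_integral_eq[OF _ has_integral_add[OF J(1) I(1)]]) (simp add: algebra_simps)
  moreover have "\<bar>pi / 2 * (\<Sum>x\<leftarrow>x # xs. \<bar>x\<bar>) - (J + I)\<bar> \<le>
      \<bar>pi / 2 * \<bar>x\<bar> - J\<bar> + \<bar>pi / 2 * (\<Sum>x\<leftarrow>xs. \<bar>x\<bar>) - I\<bar>"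
    by (simp add: algebra_simps abs_if)
  ultimately show ?case using I(2) J(2)
    by (intro exI[of _ "J + I"] conjI) (auto simp: algebra_simps add_divide_distrib)
qed simp

text \<open>
  For positive \<open>v\<close> and \<open>t\<close>, the positive root of \<open>v * h\<^sup>2 + t * h = 1\<close>. It equals the
  integral of \<open>1 / (t + \<i> * x)\<close> against the semicircle law of variance \<open>v\<close>.
\<close>

definition semicircle_transform :: "real \<Rightarrow> real \<Rightarrow> real" where
  "semicircle_transform v t = (sqrt (t\<^sup>2 + 4 * v) - t) / (2 * v)"

lemma semicircle_transform_nonneg: "0 < v \<Longrightarrow> 0 \<le> semicircle_transform v t"
proof -
  assume v: "0 < v"
  have "t \<le> sqrt (t\<^sup>2)" by simp
  also have "\<dots> \<le> sqrt (t\<^sup>2 + 4 * v)" using v by (intro real_sqrt_le_mono) simp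
  finally show ?thesis using v by (simp add: semicircle_transform_def)
qed

lemma semicircle_transform_quadratic:
  assumes "0 < v"
  shows "v * (semicircle_transform v t)\<^sup>2 + t * semicircle_transform v t = 1"
proof -
  define r where "r = sqrt (t\<^sup>2 + 4 * v)"
  have r: "r\<^sup>2 = t\<^sup>2 + 4 * v"
    using assms by (simp add: r_def)
  have "v * ((r - t) / (2 * v))\<^sup>2 + t * ((r - t) / (2 * v)) = (r\<^sup>2 - t\<^sup>2) / (4 * v)"
    using assms by (simp add: field_simps power2_eq_square)
  also have "\<dots> = 1" using assms r by simp
  finally show ?thesis by (simp add: semicircle_transform_def r_def)
qed

definition semicircle_primitive :: "real \<Rightarrow> real \<Rightarrow> real" where
  "semicircle_primitive v t = t + (t ^ 3 - (t\<^sup>2 + 4 * v) * sqrt (t\<^sup>2 + 4 * v)) / (6 * v)"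

lemma semicircle_transform_integral:
  assumes v: "0 < v" and d: "d \<le> T"
  shows "((\<lambda>t. 1 - t * semicircle_transform v t) has_integral
    (semicircle_primitive v T - semicircle_primitive v d)) {d..T}"
proof (rule fundamental_theorem_of_calculus[OF d])
  fix t
  define r where "r = sqrt (t\<^sup>2 + 4 * v)"
  have pos: "0 < t\<^sup>2 + 4 * v" using v by (simp add: add_nonneg_pos)
  have r: "0 < r" "r * r = t\<^sup>2 + 4 * v" using pos by (auto simp: r_def)
  have "(semicircle_primitive v has_real_derivative (1 + (3 * t\<^sup>2 - (2 * t * r + (t\<^sup>2 + 4 * v) * (inverse r / 2 * (2 * t)))) / (6 * v))) (at t)"
    unfolding semicircle_primitive_def[abs_def] using pos v
    by (auto intro!: derivative_eq_intros simp: r_def field_simps)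
  also have "(t\<^sup>2 + 4 * v) * (inverse r / 2 * (2 * t)) = r * t"
    using r(1) unfolding r(2)[symmetric] by (simp add: field_simps)
  also have "1 + (3 * t\<^sup>2 - (2 * t * r + r * t)) / (6 * v) = 1 - t * semicircle_transform v t"
    using v unfolding semicircle_transform_def r_def[symmetric] by (simp add: field_simps power2_eq_square)
  finally show "(semicircle_primitive v has_vector_derivative 1 - t * semicircle_transform v t) (at t within {d..T})"
    unfolding has_real_derivative_iff_has_vector_derivative by (rule has_vector_derivative_at_within)
qed

text \<open>
  The integral of \<open>1 - t * h t\<close> over the half-line: the primitive vanishes at infinity, and its
  value at 0 is \<open>- 4 / 3 * sqrt v\<close>. Up to the factor \<open>2 / pi\<close> this is the constant of the theorem.
\<close>

lemma semicircle_primitive_limit: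
  fixes v :: real
  assumes v: "0 < v"
  shows "((\<lambda>d. semicircle_primitive v (1 / d) - semicircle_primitive v d) \<longlongrightarrow> 4 / 3 * sqrt v) (at_right 0)"
proof -
  have "(semicircle_primitive v \<longlongrightarrow> 0) at_top"
    unfolding semicircle_primitive_def[abs_def] using v by real_asymp
  then have "((\<lambda>d. semicircle_primitive v (1 / d)) \<longlongrightarrow> 0) (at_right 0)"
    by (rule filterlim_compose) real_asymp
  moreover have "(semicircle_primitive v \<longlongrightarrow> semicircle_primitive v 0) (at_right 0)"
    unfolding semicircle_primitive_def[abs_def] using v by (intro tendsto_intros) auto
  ultimately have "((\<lambda>d. semicircle_primitive v (1 / d) - semicircle_primitive v d) \<longlongrightarrow> 0 - semicircle_primitive v 0) (at_right 0)"
    by (rule tendsto_diff)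
  also have "0 - semicircle_primitive v 0 = 4 / 3 * sqrt v"
    using v by (simp add: semicircle_primitive_def real_sqrt_mult)
  finally show ?thesis .
qed

section \<open>Adjacency matrices of random graphs\<close>

definition adjacency_mat :: "nat \<Rightarrow> (nat set \<Rightarrow> bool) \<Rightarrow> real mat" where
  "adjacency_mat n X = Matrix.mat n n (\<lambda>(i, j). of_bool (i \<noteq> j \<and> X {i, j}))"

lemma adjacency_mat_entry: "i < n \<Longrightarrow> j < n \<Longrightarrow> adjacency_mat n X $$ (i, j) = of_bool (i \<noteq> j \<and> X {i, j})"
  by (simp add: adjacency_mat_def)

lemma sym_mat_adjacency: "sym_mat n (adjacency_mat n X)"
  by (auto simp: sym_mat_def adjacency_mat_def insert_commute)

lemma finite_vertex_pairs [simp]: "finite (vertex_pairs n)"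
  by (rule finite_subset[of _ "Pow {..<n}"]) (auto simp: vertex_pairs_def)

lemma card_vertex_pairs_le: "real (card (vertex_pairs n)) \<le> (real n)\<^sup>2"
proof -
  have "card (vertex_pairs n) = n choose 2"
    unfolding vertex_pairs_def using n_subsets[of "{..<n}" 2] by simp
  also have "\<dots> \<le> n ^ 2"
    by (simp add: choose_two power2_eq_square le_trans[OF div_le_dividend])
  finally show ?thesis
    by (metis of_nat_le_iff of_nat_power)
qed

lemma pair_in_vertex_pairs: "a < n \<Longrightarrow> b < n \<Longrightarrow> a \<noteq> b \<Longrightarrow> {a, b} \<in> vertex_pairs n"
  by (auto simp: vertex_pairs_def)

lemma vertex_pairsE:
  assumes "e \<in> vertex_pairs n"
  obtains a b where "e = {a, b}" "a \<noteq> b" "a < n" "b < n"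
  using assms by (auto simp: vertex_pairs_def card_2_iff)

definition off_diag :: "nat \<Rightarrow> (nat \<times> nat) set" where
  "off_diag n = (SIGMA a:{..<n}. {..<n} - {a})"

lemma off_diagD: "(a, b) \<in> off_diag n \<Longrightarrow> a < n \<and> b < n \<and> a \<noteq> b"
  by (auto simp: off_diag_def)

lemma finite_off_diag [simp]: "finite (off_diag n)"
  by (simp add: off_diag_def)

lemma card_off_diag: "real (card (off_diag n)) \<le> (real n)\<^sup>2"
proof -
  have "card (off_diag n) \<le> card ({..<n} \<times> {..<n})"
    by (rule card_mono) (auto simp: off_diag_def)
  also have "\<dots> = n\<^sup>2" by (simp add: power2_eq_square)
  finally show ?thesis by (metis of_nat_le_iff of_nat_power)
qed

lemma sum_off_diag:
  fixes f :: "nat \<Rightarrow> nat \<Rightarrow> 'b :: ab_group_add"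
  shows "(\<Sum>(a, b)\<in>off_diag n. f a b) = (\<Sum>a<n. \<Sum>b<n. f a b) - (\<Sum>a<n. f a a)"
proof -
  have "(\<Sum>a<n. \<Sum>b<n. f a b) = (\<Sum>a<n. f a a + (\<Sum>b\<in>{..<n} - {a}. f a b))"
    by (intro sum.cong refl) (simp add: sum.remove[symmetric])
  also have "\<dots> = (\<Sum>a<n. f a a) + (\<Sum>(a, b)\<in>off_diag n. f a b)"
    by (simp add: sum.distrib off_diag_def sum.Sigma)
  finally show ?thesis by simp
qed

text \<open>
  The matrix \<open>D\<close> is the change of an adjacency matrix, up to a factor, when the edge \<open>{a, b}\<close> is
  flipped.
\<close>

lemma triple_product_two_entries:
  fixes M N :: "complex mat"
  assumes M: "M \<in> carrier_mat n n" and N: "N \<in> carrier_mat n n" and D: "D \<in> carrier_mat n n"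
    and ab: "a < n" "b < n" "a \<noteq> b" and ij: "i < n" "j < n"
    and entries: "\<And>k l. k < n \<Longrightarrow> l < n \<Longrightarrow>
      D $$ (k, l) = (if (k = a \<and> l = b) \<or> (k = b \<and> l = a) then c else 0)"
  shows "(M * D * N) $$ (i, j) = c * (M $$ (i, a) * N $$ (b, j) + M $$ (i, b) * N $$ (a, j))"
proof -
  have MD: "(M * D) $$ (i, l) = (if l = b then c * M $$ (i, a) else if l = a then c * M $$ (i, b) else 0)"
    if "l < n" for l
  proof -
    have "(M * D) $$ (i, l) = (\<Sum>k<n. M $$ (i, k) * D $$ (k, l))"
      using M D ij that by (intro mult_mat_entry)
    also have "\<dots> = (\<Sum>k<n. (if k = a then (if l = b then c * M $$ (i, a) else 0) else 0) +
        (if k = b then (if l = a then c * M $$ (i, b) else 0) else 0))"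
      using that ab by (intro sum.cong) (auto simp: entries)
    also have "\<dots> = (if l = b then c * M $$ (i, a) else 0) + (if l = a then c * M $$ (i, b) else 0)"
      using ab by (simp add: sum.distrib)
    finally show ?thesis using ab by auto
  qed
  have "(M * D * N) $$ (i, j) = (\<Sum>l<n. (M * D) $$ (i, l) * N $$ (l, j))"
    using M D N ij by (intro mult_mat_entry) auto
  also have "\<dots> = (\<Sum>l<n. (if l = b then c * M $$ (i, a) * N $$ (b, j) else 0) +
        (if l = a then c * M $$ (i, b) * N $$ (a, j) else 0))"
    using ab by (intro sum.cong) (auto simp: MD)
  also have "\<dots> = c * M $$ (i, a) * N $$ (b, j) + c * M $$ (i, b) * N $$ (a, j)"
    using ab by (simp add: sum.distrib)
  finally show ?thesis by (simp add: algebra_simps)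
qed

section \<open>The self-consistent equation\<close>

text \<open>
  Throughout, \<open>\<i> * t\<close> is the spectral parameter and the expectation is over the edges of the random
  graph. Resolvents are taken for every edge configuration \<open>X\<close>, so that bits of \<open>X\<close> can be
  flipped freely.
\<close>

locale gnp_resolvent =
  fixes n :: nat and p t :: real
  assumes n: "0 < n" and p: "0 < p" "p < 1" and t: "0 < t"
begin

definition s :: real where "s = 1 / sqrt n"

definition W :: "(nat set \<Rightarrow> bool) \<Rightarrow> complex mat" where
  "W X = skew_resolvent t s (adjacency_mat n X)"

definition w :: "(nat set \<Rightarrow> bool) \<Rightarrow> complex" where
  "w X = mat_trace (W X) / of_nat n"

abbreviation E :: "((nat set \<Rightarrow> bool) \<Rightarrow> 'b :: {banach, second_countable_topology}) \<Rightarrow> 'b" where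
  "E f \<equiv> measure_pmf.expectation (bernoulli_product (vertex_pairs n) p) f"

lemma s_pos: "0 < s" and s_sq: "s\<^sup>2 = 1 / n" and s_le_1: "s \<le> 1"
  using n by (auto simp: s_def power_divide)

lemma W_carrier [simp]: "W X \<in> carrier_mat n n"
  unfolding W_def by (rule skew_resolvent(1)[OF sym_mat_adjacency t])

lemma W_dim [simp]: "dim_row (W X) = n" "dim_col (W X) = n"
  using W_carrier[of X] by (auto simp del: W_carrier)

lemma W_entry: "a < n \<Longrightarrow> b < n \<Longrightarrow> cmod (W X $$ (a, b)) \<le> 1 / t"
  unfolding W_def by (rule skew_resolvent_entry[OF sym_mat_adjacency t])

text \<open>
  The resolvent identity for two graphs that differ in one edge. The difference is exact: one factor
  belongs to the graph with the edge and the other to the graph without it.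
\<close>

lemma W_flip:
  assumes ab: "a < n" "b < n" "a \<noteq> b" and ij: "i < n" "j < n"
  defines "W1 \<equiv> \<lambda>X. W (X({a, b} := True))" and "W0 \<equiv> \<lambda>X. W (X({a, b} := False))"
  shows "W1 X $$ (i, j) - W0 X $$ (i, j) =
    - (\<i> * of_real s) * (W1 X $$ (i, a) * W0 X $$ (b, j) + W1 X $$ (i, b) * W0 X $$ (a, j))"
proof -
  define D where "D = (\<i> * of_real s) \<cdot>\<^sub>m map_mat complex_of_real
     (adjacency_mat n (X({a, b} := False)) - adjacency_mat n (X({a, b} := True)))"
  have D: "D \<in> carrier_mat n n" by (auto simp: D_def adjacency_mat_def)
  have entries: "D $$ (k, l) = (if (k = a \<and> l = b) \<or> (k = b \<and> l = a) then - (\<i> * of_real s) else 0)"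
    if "k < n" "l < n" for k l
    using that ab by (auto simp: D_def adjacency_mat_def doubleton_eq_iff)
  have "W1 X - W0 X = W1 X * D * W0 X"
    unfolding D_def W1_def W0_def W_def by (rule resolvent_identity[OF sym_mat_adjacency sym_mat_adjacency t])
  moreover have "W1 X $$ (i, j) - W0 X $$ (i, j) = (W1 X - W0 X) $$ (i, j)"
    using ij by (simp add: W1_def W0_def)
  ultimately have "W1 X $$ (i, j) - W0 X $$ (i, j) = (W1 X * D * W0 X) $$ (i, j)"
    by simp
  also have "\<dots> = - (\<i> * of_real s) * (W1 X $$ (i, a) * W0 X $$ (b, j) + W1 X $$ (i, b) * W0 X $$ (a, j))"
    by (rule triple_product_two_entries[OF _ _ D ab ij entries]) (auto simp: W1_def W0_def)
  finally show ?thesis .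
qed

lemma mult_entries_le:
  assumes "a < n" "b < n" "c < n" "d < n"
  shows "cmod (W X $$ (a, b) * W Y $$ (c, d)) \<le> 1 / t\<^sup>2"
proof -
  have "cmod (W X $$ (a, b) * W Y $$ (c, d)) \<le> (1 / t) * (1 / t)"
    unfolding norm_mult using assms t by (intro mult_mono W_entry) auto
  then show ?thesis by (simp add: power2_eq_square)
qed

lemma W_flip_le:
  assumes ab: "a < n" "b < n" "a \<noteq> b" and ij: "i < n" "j < n"
  shows "cmod (W (X({a, b} := True)) $$ (i, j) - W (X({a, b} := False)) $$ (i, j)) \<le> 2 * s / t\<^sup>2"
proof -
  have "cmod (W (X({a, b} := True)) $$ (i, a) * W (X({a, b} := False)) $$ (b, j) +
      W (X({a, b} := True)) $$ (i, b) * W (X({a, b} := False)) $$ (a, j)) \<le> 1 / t\<^sup>2 + 1 / t\<^sup>2"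
    using ab ij by (intro norm_triangle_le add_mono mult_entries_le)
  then have "s * cmod (W (X({a, b} := True)) $$ (i, a) * W (X({a, b} := False)) $$ (b, j) +
      W (X({a, b} := True)) $$ (i, b) * W (X({a, b} := False)) $$ (a, j)) \<le> s * (1 / t\<^sup>2 + 1 / t\<^sup>2)"
    using s_pos by (intro mult_left_mono) auto
  then show ?thesis
    unfolding W_flip[OF assms] using s_pos by (simp add: norm_mult mult.commute)
qed

text \<open>
  By cyclicity of the trace only two entries of a product of two resolvents enter, and these are
  bounded by \<open>1 / t\<^sup>2\<close>. Together with \<open>1 / n = s\<^sup>2\<close> this gives the order \<open>n^(-3/2)\<close>; summing
  entrywise bounds would only give \<open>n^(-1/2)\<close>, too weak for the variance.
\<close>

lemma w_flip_le:
  assumes "e \<in> vertex_pairs n"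
  shows "cmod (w (X(e := True)) - w (X(e := False))) \<le> 2 * s ^ 3 / t\<^sup>2"
proof -
  obtain a b where e: "e = {a, b}" and ab: "a \<noteq> b" "a < n" "b < n"
    using assms by (rule vertex_pairsE)
  define W1 W0 where "W1 = W (X(e := True))" and "W0 = W (X(e := False))"
  have c [simp]: "W1 \<in> carrier_mat n n" "W0 \<in> carrier_mat n n" by (auto simp: W1_def W0_def)
  have "mat_trace W1 - mat_trace W0 = (\<Sum>i<n. W1 $$ (i, i) - W0 $$ (i, i))"
    by (simp add: mat_trace_def W1_def W0_def sum_subtractf)
  also have "\<dots> = (\<Sum>i<n. - (\<i> * of_real s) * (W1 $$ (i, a) * W0 $$ (b, i) + W1 $$ (i, b) * W0 $$ (a, i)))"
    unfolding W1_def W0_def e using ab by (intro sum.cong refl W_flip) auto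
  also have "\<dots> = - (\<i> * of_real s) * ((\<Sum>i<n. W0 $$ (b, i) * W1 $$ (i, a)) + (\<Sum>i<n. W0 $$ (a, i) * W1 $$ (i, b)))"
    unfolding sum_distrib_left[symmetric] sum.distrib
    by (simp only: mult.commute[of "W0 $$ (_, _)" "W1 $$ (_, _)"])
  also have "\<dots> = - (\<i> * of_real s) * ((W0 * W1) $$ (b, a) + (W0 * W1) $$ (a, b))"
    using ab by (simp add: mult_mat_entry[OF c(2,1)])
  also have "cmod \<dots> = s * cmod ((W0 * W1) $$ (b, a) + (W0 * W1) $$ (a, b))"
    using s_pos by (simp add: norm_mult)
  also have "\<dots> \<le> s * (1 / t\<^sup>2 + 1 / t\<^sup>2)"
    using s_pos ab unfolding W0_def W1_def W_def
    by (intro mult_left_mono norm_triangle_le add_mono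
        skew_resolvent_mult_entry[OF sym_mat_adjacency sym_mat_adjacency t]) auto
  finally have "cmod (mat_trace W1 - mat_trace W0) / n \<le> s * (1 / t\<^sup>2 + 1 / t\<^sup>2) / n"
    by (intro divide_right_mono) auto
  also have "\<dots> = 2 * s * (1 / n) / t\<^sup>2" by (simp add: mult_ac)
  also have "\<dots> = 2 * s ^ 3 / t\<^sup>2"
    unfolding s_sq[symmetric] by (simp add: power2_eq_square power3_eq_cube)
  finally show ?thesis
    by (simp add: w_def W1_def W0_def norm_divide flip: diff_divide_distrib)
qed

lemma trace_equation:
  "of_real t * mat_trace (W X) +
     \<i> * of_real s * (\<Sum>(a, b)\<in>off_diag n. of_bool (X {a, b}) * W X $$ (b, a)) = of_nat n"
proof -
  define M where "M = skew_shift t s (adjacency_mat n X)"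
  have M: "M \<in> carrier_mat n n" by (simp add: M_def sym_mat_carrier[OF sym_mat_adjacency])
  have entry: "M $$ (a, b) = (if a = b then of_real t else 0) + \<i> * of_real s * of_bool (a \<noteq> b \<and> X {a, b})"
    if "a < n" "b < n" for a b
    using that by (auto simp: M_def skew_shift_def adjacency_mat_def)
  have "of_nat n = mat_trace (M * W X)"
    using skew_resolvent(2)[OF sym_mat_adjacency t, of s n X] by (simp add: W_def M_def mat_trace_def)
  also have "\<dots> = (\<Sum>a<n. (M * W X) $$ (a, a))"
    using M by (simp add: mat_trace_def)
  also have "\<dots> = (\<Sum>a<n. \<Sum>b<n. M $$ (a, b) * W X $$ (b, a))"
    using M by (intro sum.cong refl mult_mat_entry) auto
  also have "\<dots> = (\<Sum>a<n. \<Sum>b<n. (if a = b then of_real t * W X $$ (a, a) else 0) +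
       \<i> * of_real s * (of_bool (a \<noteq> b \<and> X {a, b}) * W X $$ (b, a)))"
    by (intro sum.cong refl) (auto simp: entry algebra_simps)
  also have "\<dots> = (\<Sum>a<n. of_real t * W X $$ (a, a)) +
       \<i> * of_real s * (\<Sum>a<n. \<Sum>b<n. of_bool (a \<noteq> b \<and> X {a, b}) * W X $$ (b, a))"
    by (simp add: sum.distrib sum_distrib_left del: sum_of_bool_mult_eq sum_mult_of_bool_eq)
  also have "(\<Sum>a<n. \<Sum>b<n. of_bool (a \<noteq> b \<and> X {a, b}) * W X $$ (b, a)) =
      (\<Sum>(a, b)\<in>off_diag n. of_bool (a \<noteq> b \<and> X {a, b}) * W X $$ (b, a))"
    by (simp add: sum_off_diag del: sum_of_bool_mult_eq sum_mult_of_bool_eq)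
  also have "\<dots> = (\<Sum>(a, b)\<in>off_diag n. of_bool (X {a, b}) * W X $$ (b, a))"
    by (intro sum.cong refl) (auto dest!: off_diagD)
  finally show ?thesis by (simp add: mat_trace_def sum_distrib_left)
qed

definition m :: complex where "m = E w"

definition v :: real where "v = p * (1 - p)"

lemma v_pos: "0 < v" and v_le_1: "v \<le> 1"
  using p by (auto simp: v_def mult_le_one)

lemma mat_trace_W: "mat_trace (W X) = of_nat n * w X"
  using n by (simp add: w_def)

text \<open>
  The sum of the discrete derivatives that integration by parts produces, one for each
  off-diagonal position of the adjacency matrix.
\<close>

definition exchange :: "(nat set \<Rightarrow> bool) \<Rightarrow> complex" where
  "exchange X = (\<Sum>(a, b)\<in>off_diag n.
     W (X({a, b} := True)) $$ (b, a) - W (X({a, b} := False)) $$ (b, a))"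

lemma expected_trace_equation:
  "of_real t * of_nat n * m + \<i> * of_real s * of_real p * E (\<lambda>X. \<Sum>(a, b)\<in>off_diag n. W X $$ (b, a)) +
     \<i> * of_real s * of_real v * E exchange = of_nat n"
proof -
  have [simp]: "complex_of_real (of_bool P) = of_bool P" for P
    by (cases P) auto
  have bit: "E (\<lambda>X. of_bool (X {a, b}) * W X $$ (b, a)) = of_real p * E (\<lambda>X. W X $$ (b, a)) +
      of_real v * E (\<lambda>X. W (X({a, b} := True)) $$ (b, a) - W (X({a, b} := False)) $$ (b, a))"
    if "(a, b) \<in> off_diag n" for a b
    using expectation_bit_times[of "vertex_pairs n" "{a, b}" p "\<lambda>X. W X $$ (b, a)"] p
      off_diagD[OF that] pair_in_vertex_pairs[of a n b]
    by (simp add: v_def scaleR_conv_of_real)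
  have "of_nat n = E (\<lambda>X. of_real t * mat_trace (W X) +
     \<i> * of_real s * (\<Sum>(a, b)\<in>off_diag n. of_bool (X {a, b}) * W X $$ (b, a)))"
    unfolding trace_equation by simp
  also have "\<dots> = of_real t * of_nat n * m +
     \<i> * of_real s * (\<Sum>(a, b)\<in>off_diag n. E (\<lambda>X. of_bool (X {a, b}) * W X $$ (b, a)))"
    by (simp add: mat_trace_W m_def case_prod_beta' mult.assoc
        del: sum_of_bool_mult_eq sum_mult_of_bool_eq)
  also have "(\<Sum>(a, b)\<in>off_diag n. E (\<lambda>X. of_bool (X {a, b}) * W X $$ (b, a))) =
     (\<Sum>(a, b)\<in>off_diag n. of_real p * E (\<lambda>X. W X $$ (b, a)) +
      of_real v * E (\<lambda>X. W (X({a, b} := True)) $$ (b, a) - W (X({a, b} := False)) $$ (b, a)))"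
    by (intro sum.cong refl) (auto simp only: bit split: prod.splits)
  also have "\<dots> = of_real p * E (\<lambda>X. \<Sum>(a, b)\<in>off_diag n. W X $$ (b, a)) + of_real v * E exchange"
    by (simp add: exchange_def[abs_def] sum.distrib sum_distrib_left case_prod_beta')
  finally show ?thesis by (simp add: algebra_simps)
qed

lemma off_diag_sum_le: "cmod (\<Sum>(a, b)\<in>off_diag n. W X $$ (b, a)) \<le> 2 * n / t"
proof -
  have "(\<Sum>(a, b)\<in>off_diag n. W X $$ (b, a)) = (\<Sum>a<n. \<Sum>b<n. W X $$ (b, a)) - (\<Sum>a<n. W X $$ (a, a))"
    by (rule sum_off_diag)
  also have "(\<Sum>a<n. \<Sum>b<n. W X $$ (b, a)) = (\<Sum>b<n. \<Sum>a<n. W X $$ (b, a))"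
    by (rule sum.swap)
  also have "cmod ((\<Sum>b<n. \<Sum>a<n. W X $$ (b, a)) - (\<Sum>a<n. W X $$ (a, a)))
      \<le> real n / t + (\<Sum>a<n. 1 / t)"
    unfolding W_def
    by (intro norm_triangle_le_diff add_mono skew_resolvent_total[OF sym_mat_adjacency t]
         order.trans[OF norm_sum] sum_mono skew_resolvent_entry[OF sym_mat_adjacency t]) auto
  finally show ?thesis by simp
qed

text \<open>
  The configuration \<open>X\<close> agrees with one of the two flipped ones, so one of the two factors is already
  the right one.
\<close>

lemma product_flip_le:
  assumes ab: "a < n" "b < n" "a \<noteq> b" and ij: "i < n" "j < n" "k < n" "l < n"
  defines "W1 \<equiv> \<lambda>X. W (X({a, b} := True))" and "W0 \<equiv> \<lambda>X. W (X({a, b} := False))"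
  shows "cmod (W1 X $$ (i, j) * W0 X $$ (k, l) - W X $$ (i, j) * W X $$ (k, l)) \<le> 2 * s / t ^ 3"
proof (cases "X {a, b}")
  case True
  then have X: "X({a, b} := True) = X" by (intro fun_upd_idem) simp
  have "cmod (W1 X $$ (i, j) * W0 X $$ (k, l) - W X $$ (i, j) * W X $$ (k, l)) =
      cmod (W X $$ (i, j)) * cmod (W1 X $$ (k, l) - W0 X $$ (k, l))"
    unfolding W1_def X by (simp add: norm_minus_commute flip: norm_mult right_diff_distrib)
  also have "\<dots> \<le> (1 / t) * (2 * s / t\<^sup>2)"
    unfolding W1_def W0_def using ab ij t by (intro mult_mono W_entry W_flip_le) auto
  finally show ?thesis by (simp add: power2_eq_square power3_eq_cube)
next
  case False
  then have X: "X({a, b} := False) = X" by (intro fun_upd_idem) simp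
  have "cmod (W1 X $$ (i, j) * W0 X $$ (k, l) - W X $$ (i, j) * W X $$ (k, l)) =
      cmod (W1 X $$ (i, j) - W0 X $$ (i, j)) * cmod (W X $$ (k, l))"
    unfolding W0_def X by (simp flip: norm_mult left_diff_distrib)
  also have "\<dots> \<le> (2 * s / t\<^sup>2) * (1 / t)"
    unfolding W1_def W0_def using ab ij t s_pos by (intro mult_mono W_entry W_flip_le) auto
  finally show ?thesis by (simp add: power2_eq_square power3_eq_cube)
qed

text \<open>
  Both sums consist of squares of distinct entries, hence they are controlled by the Frobenius norm,
  which is of order \<open>sqrt n\<close> rather than \<open>n\<close>.
\<close>

lemma diagonal_correction_le:
  "cmod ((\<Sum>(a, b)\<in>off_diag n. (W X $$ (b, a))\<^sup>2) - (\<Sum>a<n. (W X $$ (a, a))\<^sup>2)) \<le> n / t\<^sup>2"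
proof -
  have "cmod ((\<Sum>(a, b)\<in>off_diag n. (W X $$ (b, a))\<^sup>2) - (\<Sum>a<n. (W X $$ (a, a))\<^sup>2))
      \<le> (\<Sum>(a, b)\<in>off_diag n. (cmod (W X $$ (b, a)))\<^sup>2) + (\<Sum>a<n. (cmod (W X $$ (a, a)))\<^sup>2)"
    by (intro norm_triangle_le_diff add_mono order.trans[OF norm_sum] sum_mono)
       (auto simp: norm_power)
  also have "\<dots> = (\<Sum>a<n. \<Sum>b<n. (cmod (W X $$ (b, a)))\<^sup>2)"
    by (simp add: sum_off_diag)
  also have "\<dots> = (\<Sum>b<n. \<Sum>a<n. (cmod (W X $$ (b, a)))\<^sup>2)"
    by (rule sum.swap)
  also have "\<dots> \<le> n / t\<^sup>2"
    unfolding W_def by (rule skew_resolvent_frobenius[OF sym_mat_adjacency t])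
  finally show ?thesis .
qed

text \<open>
  Here the quadratic term of the limiting equation appears: the products of two diagonal entries add up
  to the square of the trace, while the products of off-diagonal entries and the omitted diagonal
  positions are of lower order.
\<close>

lemma exchange_approx:
  "cmod (\<i> * of_real s * exchange X - of_nat n * (w X)\<^sup>2) \<le> n * (4 * s / t ^ 3) + 1 / t\<^sup>2"
proof -
  \<comment> \<open>\<open>Y\<close> collects the error of replacing flipped resolvents by \<open>W X\<close>; \<open>R\<close> is what distinguishes
    the resulting sum from the square of the trace.\<close>
  define Y where "Y = (\<Sum>(a, b)\<in>off_diag n.
    (W (X({a, b} := True)) $$ (b, a) * W (X({a, b} := False)) $$ (b, a) - W X $$ (b, a) * W X $$ (b, a)) +
    (W (X({a, b} := True)) $$ (b, b) * W (X({a, b} := False)) $$ (a, a) - W X $$ (b, b) * W X $$ (a, a)))"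
  define R where "R = (\<Sum>(a, b)\<in>off_diag n. (W X $$ (b, a))\<^sup>2) - (\<Sum>a<n. (W X $$ (a, a))\<^sup>2)"
  have s2: "complex_of_real s * of_real s = 1 / of_nat n"
    using s_sq by (simp add: power2_eq_square flip: of_real_mult)
  have "\<i> * of_real s * exchange X = (\<Sum>(a, b)\<in>off_diag n. \<i> * of_real s *
      (- (\<i> * of_real s) * (W (X({a, b} := True)) $$ (b, a) * W (X({a, b} := False)) $$ (b, a) +
        W (X({a, b} := True)) $$ (b, b) * W (X({a, b} := False)) $$ (a, a))))"
    unfolding exchange_def sum_distrib_left
  proof (intro sum.cong refl, clarify)
    fix a b assume "(a, b) \<in> off_diag n"
    from off_diagD[OF this] have "a < n" "b < n" "a \<noteq> b" by auto
    then show "\<i> * of_real s * (W (X({a, b} := True)) $$ (b, a) - W (X({a, b} := False)) $$ (b, a)) =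
      \<i> * of_real s * (- (\<i> * of_real s) * (W (X({a, b} := True)) $$ (b, a) * W (X({a, b} := False)) $$ (b, a) +
        W (X({a, b} := True)) $$ (b, b) * W (X({a, b} := False)) $$ (a, a)))"
      by (subst W_flip) auto
  qed
  also have "\<dots> = (\<Sum>(a, b)\<in>off_diag n. of_real s * of_real s *
      (W (X({a, b} := True)) $$ (b, a) * W (X({a, b} := False)) $$ (b, a) +
        W (X({a, b} := True)) $$ (b, b) * W (X({a, b} := False)) $$ (a, a)))"
    by (intro sum.cong refl) (auto simp: algebra_simps)
  also have "\<dots> = 1 / of_nat n * (\<Sum>(a, b)\<in>off_diag n.
      (W (X({a, b} := True)) $$ (b, a) * W (X({a, b} := False)) $$ (b, a) +
        W (X({a, b} := True)) $$ (b, b) * W (X({a, b} := False)) $$ (a, a)))"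
    unfolding s2 by (simp only: sum_distrib_left case_prod_beta')
  also have "(\<Sum>(a, b)\<in>off_diag n.
      (W (X({a, b} := True)) $$ (b, a) * W (X({a, b} := False)) $$ (b, a) +
        W (X({a, b} := True)) $$ (b, b) * W (X({a, b} := False)) $$ (a, a))) =
      Y + (\<Sum>(a, b)\<in>off_diag n. (W X $$ (b, a))\<^sup>2 + W X $$ (b, b) * W X $$ (a, a))"
    unfolding Y_def sum.distrib[symmetric]
    by (intro sum.cong refl) (auto simp: power2_eq_square)
  also have "(\<Sum>(a, b)\<in>off_diag n. (W X $$ (b, a))\<^sup>2 + W X $$ (b, b) * W X $$ (a, a)) =
      R + (mat_trace (W X))\<^sup>2"
  proof -
    have "(\<Sum>(a, b)\<in>off_diag n. W X $$ (b, b) * W X $$ (a, a)) =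
        (\<Sum>a<n. \<Sum>b<n. W X $$ (b, b) * W X $$ (a, a)) - (\<Sum>a<n. (W X $$ (a, a))\<^sup>2)"
      by (simp add: sum_off_diag power2_eq_square)
    also have "(\<Sum>a<n. \<Sum>b<n. W X $$ (b, b) * W X $$ (a, a)) = (mat_trace (W X))\<^sup>2"
      by (simp add: mat_trace_def power2_eq_square sum_product mult.commute)
    finally have diag: "(\<Sum>(a, b)\<in>off_diag n. W X $$ (b, b) * W X $$ (a, a)) =
        (mat_trace (W X))\<^sup>2 - (\<Sum>a<n. (W X $$ (a, a))\<^sup>2)" .
    have "(\<Sum>(a, b)\<in>off_diag n. (W X $$ (b, a))\<^sup>2 + W X $$ (b, b) * W X $$ (a, a)) =
        (\<Sum>(a, b)\<in>off_diag n. (W X $$ (b, a))\<^sup>2) + (\<Sum>(a, b)\<in>off_diag n. W X $$ (b, b) * W X $$ (a, a))"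
      by (simp add: case_prod_beta' sum.distrib)
    then show ?thesis unfolding R_def diag by simp
  qed
  finally have "\<i> * of_real s * exchange X - of_nat n * (w X)\<^sup>2 = (Y + R) / of_nat n"
    using n by (simp add: mat_trace_W field_simps power2_eq_square)
  then have "cmod (\<i> * of_real s * exchange X - of_nat n * (w X)\<^sup>2) = cmod (Y + R) / n"
    by (simp add: norm_divide)
  also have "\<dots> \<le> ((real n)\<^sup>2 * (4 * s / t ^ 3) + n / t\<^sup>2) / n"
  proof (intro divide_right_mono norm_triangle_le add_mono)
    have "cmod Y \<le> (\<Sum>(a, b)\<in>off_diag n. 2 * s / t ^ 3 + 2 * s / t ^ 3)"
      unfolding Y_def
    proof (intro order.trans[OF norm_sum] sum_mono, clarify)
      fix a b assume "(a, b) \<in> off_diag n"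
      from off_diagD[OF this] have "a < n" "b < n" "a \<noteq> b" by auto
      then show "cmod ((W (X({a, b} := True)) $$ (b, a) * W (X({a, b} := False)) $$ (b, a) - W X $$ (b, a) * W X $$ (b, a)) +
          (W (X({a, b} := True)) $$ (b, b) * W (X({a, b} := False)) $$ (a, a) - W X $$ (b, b) * W X $$ (a, a)))
          \<le> 2 * s / t ^ 3 + 2 * s / t ^ 3"
        by (intro norm_triangle_le add_mono product_flip_le)
    qed
    also have "\<dots> = real (card (off_diag n)) * (4 * s / t ^ 3)"
      by (simp add: case_prod_beta')
    also have "\<dots> \<le> (real n)\<^sup>2 * (4 * s / t ^ 3)"
      using s_pos t by (intro mult_right_mono card_off_diag) auto
    finally show "cmod Y \<le> (real n)\<^sup>2 * (4 * s / t ^ 3)" .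
    show "cmod R \<le> n / t\<^sup>2"
      unfolding R_def by (rule diagonal_correction_le)
  qed simp
  also have "\<dots> = n * (4 * s / t ^ 3) + 1 / t\<^sup>2"
    using n by (simp add: power2_eq_square add_divide_distrib)
  finally show ?thesis .
qed

text \<open>
  The mean \<open>p\<close> of the entries of the adjacency matrix contributes only the sum over all entries of the
  resolvent, which is of order \<open>n\<close>. Thus the one large eigenvalue caused by the mean
  only affects the error term.
\<close>

lemma self_consistency_in_expectation:
  "cmod (of_real t * m + of_real v * E (\<lambda>X. (w X)\<^sup>2) - 1) \<le> s * (2 / t + 4 / t ^ 3 + 1 / t\<^sup>2)"
proof -
  define S1 where "S1 = E (\<lambda>X. \<Sum>(a, b)\<in>off_diag n. W X $$ (b, a))"
  define D where "D = E (\<lambda>X. \<i> * of_real s * exchange X - of_nat n * (w X)\<^sup>2)"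
  have S1: "cmod S1 \<le> 2 * n / t"
    unfolding S1_def by (intro expectation_norm_le off_diag_sum_le) auto
  have D: "cmod D \<le> n * (4 * s / t ^ 3) + 1 / t\<^sup>2"
    unfolding D_def by (intro expectation_norm_le exchange_approx) auto
  have D_eq: "D = \<i> * of_real s * E exchange - of_nat n * E (\<lambda>X. (w X)\<^sup>2)"
    unfolding D_def by simp
  have "of_nat n * (of_real t * m + of_real v * E (\<lambda>X. (w X)\<^sup>2) - 1) +
     (\<i> * of_real s * of_real p * S1 + of_real v * D) =
     (of_real t * of_nat n * m + \<i> * of_real s * of_real p * S1 +
      \<i> * of_real s * of_real v * E exchange) - of_nat n"
    unfolding D_eq by (simp add: algebra_simps)
  also have "\<dots> = 0"
    unfolding S1_def expected_trace_equation by simp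
  finally have "of_nat n * (of_real t * m + of_real v * E (\<lambda>X. (w X)\<^sup>2) - 1) =
     - (\<i> * of_real s * of_real p * S1 + of_real v * D)"
    by (simp only: eq_neg_iff_add_eq_0)
  then have "n * cmod (of_real t * m + of_real v * E (\<lambda>X. (w X)\<^sup>2) - 1) =
     cmod (\<i> * of_real s * of_real p * S1 + of_real v * D)"
    by (metis norm_minus_cancel norm_mult norm_of_nat)
  also have "\<dots> \<le> s * p * cmod S1 + v * cmod D"
    using s_pos p v_pos by (intro norm_triangle_le) (simp add: norm_mult)
  also have "\<dots> \<le> s * 1 * (2 * n / t) + 1 * (n * (4 * s / t ^ 3) + 1 / t\<^sup>2)"
    using s_pos p v_pos v_le_1 by (intro add_mono mult_mono S1 D) auto
  also have "\<dots> = n * (s * (2 / t + 4 / t ^ 3) + (1 / n) / t\<^sup>2)"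
    using n by (simp add: algebra_simps)
  also have "\<dots> = n * (s * (2 / t + 4 / t ^ 3) + s\<^sup>2 / t\<^sup>2)"
    by (simp add: s_sq)
  also have "\<dots> \<le> n * (s * (2 / t + 4 / t ^ 3) + s / t\<^sup>2)"
    using s_pos s_le_1 by (intro mult_left_mono add_left_mono divide_right_mono) (auto simp: power2_eq_square)
  finally have "cmod (of_real t * m + of_real v * E (\<lambda>X. (w X)\<^sup>2) - 1) \<le> s * (2 / t + 4 / t ^ 3) + s / t\<^sup>2"
    using n by (simp only: mult_le_cancel_left_pos of_nat_0_less_iff)
  then show ?thesis by (simp add: algebra_simps)
qed

lemma w_variance: "E (\<lambda>X. (cmod (w X - m))\<^sup>2) \<le> 8 * s\<^sup>2 / t ^ 4"
proof -
  have "E (\<lambda>X. (cmod (w X - m))\<^sup>2) \<le> 2 * real (card (vertex_pairs n)) * (2 * s ^ 3 / t\<^sup>2)\<^sup>2"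
    unfolding m_def using p by (intro variance_complex_bernoulli w_flip_le) auto
  also have "\<dots> \<le> 2 * (real n)\<^sup>2 * (2 * s ^ 3 / t\<^sup>2)\<^sup>2"
    by (intro mult_right_mono mult_left_mono card_vertex_pairs_le) auto
  also have "\<dots> = 8 * s\<^sup>2 / t ^ 4 * (real n * s\<^sup>2)\<^sup>2"
    by (simp add: power_mult_distrib power_divide flip: power_mult)
  also have "real n * s\<^sup>2 = 1" using n by (simp add: s_sq)
  finally show ?thesis by simp
qed

lemma Re_w_nonneg: "0 \<le> Re (w X)"
proof -
  obtain rs where "length rs = n"
    and rs: "\<And>t' s'. 0 < t' \<Longrightarrow> mat_trace (skew_resolvent t' s' (adjacency_mat n X)) =
      (\<Sum>r\<leftarrow>rs. 1 / (of_real t' + \<i> * of_real (s' * r)))"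
    by (rule sym_mat_spectrum[OF sym_mat_adjacency[of n X]]) blast
  have "0 \<le> Re (\<Sum>r\<leftarrow>rs. 1 / (of_real t + \<i> * of_real (s * r)))" for rs
  proof (induction rs)
    case (Cons r rs)
    then show ?case using t Re_inverse_skew[OF t, of "s * r"] by simp
  qed simp
  then show ?thesis
    unfolding w_def W_def rs[OF t] by (simp add: Re_divide_of_nat)
qed

text \<open>
  The left-hand side of the equation minus its value at the root \<open>h\<close> factors as
  \<open>(z - h) * (v * (z + h) + t)\<close>, and the second factor has real part at least \<open>t\<close>.
\<close>

lemma quadratic_stability:
  fixes z :: complex
  assumes "0 \<le> Re z"
  shows "t * cmod (z - of_real (semicircle_transform v t)) \<le> cmod (of_real t * z + of_real v * z\<^sup>2 - 1)"
proof -
  define h where "h = semicircle_transform v t"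
  have h: "0 \<le> h" "v * h\<^sup>2 + t * h = 1"
    using semicircle_transform_nonneg[OF v_pos] semicircle_transform_quadratic[OF v_pos]
    by (auto simp: h_def)
  have "(z - of_real h) * (of_real v * (z + of_real h) + of_real t) =
     of_real t * z + of_real v * z\<^sup>2 - of_real (v * h\<^sup>2 + t * h)"
    by (simp add: algebra_simps power2_eq_square)
  then have "cmod (of_real t * z + of_real v * z\<^sup>2 - 1) =
      cmod (z - of_real h) * cmod (of_real v * (z + of_real h) + of_real t)"
    unfolding h(2) by (metis norm_mult of_real_1)
  moreover have "t \<le> Re (of_real v * (z + of_real h) + of_real t)"
    using assms h(1) v_pos by simp
  then have "t \<le> cmod (of_real v * (z + of_real h) + of_real t)"
    using complex_Re_le_cmod order.trans by blast
  then have "t * cmod (z - of_real h) \<le> cmod (of_real v * (z + of_real h) + of_real t) * cmod (z - of_real h)"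
    by (rule mult_right_mono) simp
  ultimately show ?thesis
    unfolding h_def[symmetric] by (simp add: mult.commute)
qed

text \<open>
  The term \<open>3 / t\<^sup>2\<close> accounts for the fluctuations of \<open>w\<close> around its mean \<open>m\<close>, and the other one
  for the distance of \<open>m\<close> from the root. Replacing \<open>E (w\<^sup>2)\<close> by \<open>m\<^sup>2\<close> in the equation costs the
  variance again.
\<close>

theorem w_close_to_semicircle:
  "E (\<lambda>X. cmod (w X - of_real (semicircle_transform v t))) \<le>
    s * (3 / t\<^sup>2 + (2 / t + 4 / t ^ 3 + 1 / t\<^sup>2 + 8 / t ^ 4) / t)"
proof -
  define h where "h = complex_of_real (semicircle_transform v t)"
  define F where "F = E (\<lambda>X. (w X - m)\<^sup>2)"
  have "F = E (\<lambda>X. (w X)\<^sup>2 - 2 * m * w X + m\<^sup>2)"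
    unfolding F_def by (simp add: power2_diff mult_ac)
  also have "\<dots> = E (\<lambda>X. (w X)\<^sup>2) - 2 * m * E w + m\<^sup>2"
    by simp
  finally have F: "E (\<lambda>X. (w X)\<^sup>2) = m\<^sup>2 + F"
    by (simp add: m_def[symmetric] power2_eq_square)
  have "cmod F \<le> E (\<lambda>X. cmod ((w X - m)\<^sup>2))"
    unfolding F_def by (rule integral_norm_bound)
  also have "\<dots> \<le> 8 * s\<^sup>2 / t ^ 4"
    using w_variance by (simp add: norm_power)
  also have "\<dots> \<le> s * (8 / t ^ 4)"
    using s_pos s_le_1 t by (simp add: power2_eq_square divide_right_mono)
  finally have F_le: "cmod F \<le> s * (8 / t ^ 4)" .
  have "t * cmod (m - h) \<le> cmod (of_real t * m + of_real v * m\<^sup>2 - 1)"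
    unfolding h_def
  proof (rule quadratic_stability)
    have "0 \<le> E (\<lambda>X. Re (w X))"
      by (intro Bochner_Integration.integral_nonneg Re_w_nonneg)
    also have "\<dots> = Re m" by (simp add: m_def)
    finally show "0 \<le> Re m" .
  qed
  also have "of_real t * m + of_real v * m\<^sup>2 - 1 =
      (of_real t * m + of_real v * E (\<lambda>X. (w X)\<^sup>2) - 1) - of_real v * F"
    unfolding F by (simp add: algebra_simps)
  also have "cmod \<dots> \<le> s * (2 / t + 4 / t ^ 3 + 1 / t\<^sup>2) + 1 * (s * (8 / t ^ 4))"
  proof (rule norm_triangle_le_diff, rule add_mono[OF self_consistency_in_expectation])
    have "cmod (of_real v * F) = v * cmod F" using v_pos by (simp add: norm_mult)
    also have "\<dots> \<le> 1 * (s * (8 / t ^ 4))"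
      using v_le_1 F_le s_pos t by (intro mult_mono) auto
    finally show "cmod (of_real v * F) \<le> 1 * (s * (8 / t ^ 4))" .
  qed
  also have "\<dots> = s * (2 / t + 4 / t ^ 3 + 1 / t\<^sup>2 + 8 / t ^ 4)"
    by (simp add: algebra_simps)
  finally have mh: "cmod (m - h) \<le> s * ((2 / t + 4 / t ^ 3 + 1 / t\<^sup>2 + 8 / t ^ 4) / t)"
    using t by (simp add: pos_le_divide_eq mult.commute)
  have "E (\<lambda>X. cmod (w X - m)) \<le> sqrt (E (\<lambda>X. (cmod (w X - m))\<^sup>2))"
    by (rule expectation_le_sqrt) simp
  also have "\<dots> \<le> sqrt ((s * (3 / t\<^sup>2))\<^sup>2)"
  proof (rule real_sqrt_le_mono, rule order.trans[OF w_variance])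
    \<comment> \<open>Rounding 8 up to the square 9 avoids a square root in the final bound.\<close>
    have "8 * s\<^sup>2 / t ^ 4 \<le> 9 * s\<^sup>2 / t ^ 4"
      by (intro divide_right_mono) auto
    then show "8 * s\<^sup>2 / t ^ 4 \<le> (s * (3 / t\<^sup>2))\<^sup>2"
      by (simp add: power_mult_distrib power_divide mult.commute flip: power_mult)
  qed
  also have "\<dots> = s * (3 / t\<^sup>2)"
    using s_pos by simp
  finally have wm: "E (\<lambda>X. cmod (w X - m)) \<le> s * (3 / t\<^sup>2)" .
  have "E (\<lambda>X. cmod (w X - h)) \<le> E (\<lambda>X. cmod (w X - m) + cmod (m - h))"
    by (intro integral_mono) (auto intro: norm_triangle_sub order.trans[OF _ norm_triangle_ineq])
  also have "\<dots> = E (\<lambda>X. cmod (w X - m)) + cmod (m - h)"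
    by simp
  also have "\<dots> \<le> s * (3 / t\<^sup>2) + s * ((2 / t + 4 / t ^ 3 + 1 / t\<^sup>2 + 8 / t ^ 4) / t)"
    by (intro add_mono wm mh)
  finally show ?thesis unfolding h_def by (simp add: distrib_left)
qed

end

section \<open>Convergence of the adjacency energy\<close>

text \<open>
  Fubini for a finite probability space.
\<close>

lemma expectation_has_integral:
  fixes g :: "('a \<Rightarrow> bool) \<Rightarrow> real \<Rightarrow> real"
  assumes S: "finite S" and g: "\<And>X. (g X has_integral G X) A"
  shows "((\<lambda>t. measure_pmf.expectation (bernoulli_product S p) (\<lambda>X. g X t)) has_integral
     measure_pmf.expectation (bernoulli_product S p) G) A"
proof -
  let ?P = "bernoulli_product S p"
  have E: "measure_pmf.expectation ?P f = (\<Sum>X\<in>set_pmf ?P. f X * pmf ?P X)" for f :: "_ \<Rightarrow> real"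
    using S by (intro integral_measure_pmf_real) auto
  show ?thesis
    unfolding E using S g by (intro has_integral_sum has_integral_mult_left) auto
qed

definition normalized_energy :: "nat \<Rightarrow> (nat set \<Rightarrow> bool) \<Rightarrow> real" where
  "normalized_energy n X = matrix_energy (adjacency_mat n X) / (real n * sqrt (real n))"

lemma continuous_on_spectral_sum:
  "continuous_on {0<..} (\<lambda>t. \<Sum>x\<leftarrow>xs. 1 / (complex_of_real t + \<i> * of_real x))"
proof (induction xs)
  case (Cons x xs)
  have "complex_of_real t + \<i> * of_real x \<noteq> 0" if "0 < t" for t
    using that by (simp add: complex_eq_iff)
  then have "continuous_on {0<..} (\<lambda>t. 1 / (complex_of_real t + \<i> * of_real x))"
    by (intro continuous_intros) auto
  from continuous_on_add[OF this Cons] show ?case by simp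
qed simp

text \<open>
  The squares of the eigenvalues add up to the sum of the squared entries of the adjacency matrix, at
  most \<open>n\<^sup>2\<close>. After scaling their average is at most 1, which bounds the cost of the upper cutoff \<open>T\<close>
  uniformly over all graphs.
\<close>

lemma normalized_energy_poisson:
  assumes n: "0 < n" and d: "0 < d" "d \<le> T"
  obtains I where "((\<lambda>t. 1 - t * Re (gnp_resolvent.w n t X)) has_integral I) {d..T}"
    "continuous_on {d..T} (\<lambda>t. gnp_resolvent.w n t X)"
    "\<bar>pi / 2 * normalized_energy n X - I\<bar> \<le> d + 1 / T"
proof -
  define c where "c = 1 / sqrt (real n)"
  have c: "0 < c" "c\<^sup>2 = 1 / n" using n by (auto simp: c_def power_divide)
  obtain rs where rs: "length rs = n" "proots (char_poly (adjacency_mat n X)) = mset rs"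
    "(\<Sum>r\<leftarrow>rs. r\<^sup>2) = (\<Sum>i<n. \<Sum>j<n. (adjacency_mat n X $$ (i, j))\<^sup>2)"
    "\<And>t s. 0 < t \<Longrightarrow> mat_trace (skew_resolvent t s (adjacency_mat n X)) =
      (\<Sum>r\<leftarrow>rs. 1 / (of_real t + \<i> * of_real (s * r)))"
    by (rule sym_mat_spectrum[OF sym_mat_adjacency[of n X]]) blast
  \<comment> \<open>The eigenvalues of the scaled matrix \<open>A / sqrt n\<close>.\<close>
  define xs where "xs = map (\<lambda>r. c * r) rs"
  have len: "length xs = n" by (simp add: xs_def rs(1))
  obtain I where I: "((\<lambda>t. real (length xs) - t * Re (\<Sum>x\<leftarrow>xs. 1 / (of_real t + \<i> * of_real x))) has_integral I) {d..T}"
    and I_le: "\<bar>pi / 2 * (\<Sum>x\<leftarrow>xs. \<bar>x\<bar>) - I\<bar> \<le> real (length xs) * d + (\<Sum>x\<leftarrow>xs. x\<^sup>2) / T"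
    using sum_abs_poisson_integral[OF d] by blast
  have w: "gnp_resolvent.w n t X = (\<Sum>x\<leftarrow>xs. 1 / (of_real t + \<i> * of_real x)) / of_nat n"
    if t: "t \<in> {d..T}" for t
  proof -
    have t: "0 < t" using t d by simp
    interpret gnp_resolvent n "1 / 2" t
      using n t by unfold_locales auto
    show ?thesis
      unfolding w_def W_def rs(4)[OF t] xs_def s_def[folded c_def]
      by (simp add: o_def)
  qed
  have "((\<lambda>t. 1 - t * Re (gnp_resolvent.w n t X)) has_integral (I / n)) {d..T}"
  proof (rule has_integral_eq[OF _ has_integral_divide[OF I]])
    fix t assume "t \<in> {d..T}"
    then show "(real (length xs) - t * Re (\<Sum>x\<leftarrow>xs. 1 / (of_real t + \<i> * of_real x))) / n =
        1 - t * Re (gnp_resolvent.w n t X)"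
      unfolding w[OF \<open>t \<in> {d..T}\<close>] len Re_divide_of_nat
      using n by (simp add: diff_divide_distrib)
  qed
  moreover have "continuous_on {d..T} (\<lambda>t. (\<Sum>x\<leftarrow>xs. 1 / (of_real t + \<i> * of_real x)) / of_nat n)"
    using d n by (intro continuous_intros continuous_on_subset[OF continuous_on_spectral_sum]) auto
  then have "continuous_on {d..T} (\<lambda>t. gnp_resolvent.w n t X)"
    by (subst continuous_on_cong[OF refl w])
  moreover have "\<bar>pi / 2 * normalized_energy n X - I / n\<bar> \<le> d + 1 / T"
  proof -
    have T: "0 < T" using d by simp
    have scale: "(\<Sum>r\<leftarrow>rs. \<bar>c * r\<bar>) = c * (\<Sum>r\<leftarrow>rs. \<bar>r\<bar>)" "(\<Sum>r\<leftarrow>rs. (c * r)\<^sup>2) = c\<^sup>2 * (\<Sum>r\<leftarrow>rs. r\<^sup>2)" for rs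
      using c(1) by (simp_all add: abs_mult power_mult_distrib flip: sum_list_const_mult)
    have "matrix_energy (adjacency_mat n X) = (\<Sum>r\<leftarrow>rs. \<bar>r\<bar>)"
      unfolding matrix_energy_def rs(2) by (simp flip: sum_mset_sum_list)
    then have energy: "normalized_energy n X = (\<Sum>x\<leftarrow>xs. \<bar>x\<bar>) / n"
      by (simp add: normalized_energy_def xs_def o_def scale) (simp add: c_def mult.commute)
    have "(\<Sum>i<n. \<Sum>j<n. (adjacency_mat n X $$ (i, j))\<^sup>2) \<le> (\<Sum>i<n. \<Sum>j<n. 1)"
      by (intro sum_mono) (simp add: adjacency_mat_entry)
    then have "(\<Sum>r\<leftarrow>rs. r\<^sup>2) \<le> real n * real n"
      unfolding rs(3) by simp
    then have "(\<Sum>x\<leftarrow>xs. x\<^sup>2) \<le> c\<^sup>2 * (real n * real n)"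
      by (simp add: xs_def o_def scale mult_left_mono)
    also have "\<dots> = n" using n by (simp add: c(2))
    finally have sq: "(\<Sum>x\<leftarrow>xs. x\<^sup>2) / T \<le> n / T"
      using T by (intro divide_right_mono) auto
    have "pi / 2 * normalized_energy n X - I / n = (pi / 2 * (\<Sum>x\<leftarrow>xs. \<bar>x\<bar>) - I) / n"
      unfolding energy by (simp add: diff_divide_distrib)
    then have "\<bar>pi / 2 * normalized_energy n X - I / n\<bar> = \<bar>pi / 2 * (\<Sum>x\<leftarrow>xs. \<bar>x\<bar>) - I\<bar> / n"
      by (simp only: abs_divide abs_of_nat)
    also have "\<dots> \<le> (real n * d + n / T) / n"
      using I_le sq rs(1) by (intro divide_right_mono) (auto simp: xs_def)
    also have "\<dots> = d + 1 / T"
      using n by (simp add: add_divide_distrib)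
    finally show ?thesis .
  qed
  ultimately show ?thesis by (rule that)
qed

text \<open>
  The constant \<open>C\<close> is \<open>T\<close> times the bound of \<open>w_close_to_semicircle\<close> at \<open>t = d\<close>, without the
  factor \<open>s\<close>; the bound is largest there on the interval of integration.
\<close>

lemma energy_deviation:
  assumes n: "0 < n" and p: "0 < p" "p < 1" and d: "0 < d" "d \<le> T"
  defines "C \<equiv> T * (3 / d\<^sup>2 + (2 / d + 4 / d ^ 3 + 1 / d\<^sup>2 + 8 / d ^ 4) / d)"
  defines "J \<equiv> semicircle_primitive (p * (1 - p)) T - semicircle_primitive (p * (1 - p)) d"
  shows "measure_pmf.expectation (bernoulli_product (vertex_pairs n) p)
     (\<lambda>X. \<bar>pi / 2 * normalized_energy n X - J\<bar>) \<le> d + 1 / T + C / sqrt n * (T - d)"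
proof -
  let ?E = "measure_pmf.expectation (bernoulli_product (vertex_pairs n) p) :: _ \<Rightarrow> real"
  define q where "q = p * (1 - p)"
  define tr where "tr t X = gnp_resolvent.w n t X" for t X
  define h where "h t = semicircle_transform q t" for t
  have q: "0 < q" using p by (simp add: q_def)
  have "\<exists>I. ((\<lambda>t. 1 - t * Re (tr t X)) has_integral I) {d..T} \<and>
      continuous_on {d..T} (\<lambda>t. tr t X) \<and>
      \<bar>pi / 2 * normalized_energy n X - I\<bar> \<le> d + 1 / T" for X
    unfolding tr_def by (rule normalized_energy_poisson[OF n d, of X]) blast
  then obtain I where I: "\<And>X. ((\<lambda>t. 1 - t * Re (tr t X)) has_integral I X) {d..T}"
    "\<And>X. \<bar>pi / 2 * normalized_energy n X - I X\<bar> \<le> d + 1 / T"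
    and tr_cont: "\<And>X. continuous_on {d..T} (\<lambda>t. tr t X)"
    by metis
  have J: "((\<lambda>t. 1 - t * h t) has_integral J) {d..T}"
    unfolding h_def J_def q_def[symmetric]
    by (rule semicircle_transform_integral[OF q d(2)])
  have diff: "((\<lambda>t. t * (h t - Re (tr t X))) has_integral (I X - J)) {d..T}" for X
    by (rule has_integral_eq[OF _ has_integral_diff[OF I(1) J]]) (simp add: algebra_simps)
  define G where "G X = integral {d..T} (\<lambda>t. \<bar>t * (h t - Re (tr t X))\<bar>)" for X
  have cont: "continuous_on {d..T} (\<lambda>t. t * (h t - Re (tr t X)))" for X
    unfolding h_def semicircle_transform_def using q tr_cont[of X]
    by (intro continuous_intros) auto
  have G: "((\<lambda>t. \<bar>t * (h t - Re (tr t X))\<bar>) has_integral G X) {d..T}" for X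
    unfolding G_def
    by (intro integrable_integral integrable_continuous_interval continuous_intros cont)
  have IJ: "\<bar>I X - J\<bar> \<le> G X" for X
    unfolding G_def integral_unique[OF diff, symmetric] real_norm_def[symmetric]
    by (rule integral_norm_bound_integral) (use diff G in \<open>auto simp: integrable_on_def\<close>)
  have "?E G \<le> C / sqrt n * (T - d)"
  proof (rule has_integral_le[OF expectation_has_integral[OF _ G]])
    show "((\<lambda>t. C / sqrt n) has_integral C / sqrt n * (T - d)) {d..T}"
      using has_integral_const_real[of "C / sqrt n" d T] d by (simp add: mult.commute)
    fix t assume t_mem: "t \<in> {d..T}"
    then have t0: "0 < t" using d by simp
    interpret gnp_resolvent n p t
      using n p t0 by unfold_locales auto
    have "?E (\<lambda>X. \<bar>t * (h t - Re (gnp_resolvent.w n t X))\<bar>) \<le> ?E (\<lambda>X. t * cmod (gnp_resolvent.w n t X - of_real (h t)))"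
    proof (intro integral_mono)
      fix X
      have "\<bar>h t - Re (gnp_resolvent.w n t X)\<bar> \<le> cmod (gnp_resolvent.w n t X - of_real (h t))"
        using abs_Re_le_cmod[of "gnp_resolvent.w n t X - of_real (h t)"] by simp
      then show "\<bar>t * (h t - Re (gnp_resolvent.w n t X))\<bar> \<le> t * cmod (gnp_resolvent.w n t X - of_real (h t))"
        using t0 by (simp add: abs_mult)
    qed auto
    also have "\<dots> = t * ?E (\<lambda>X. cmod (gnp_resolvent.w n t X - of_real (h t)))"
      by simp
    also have "\<dots> \<le> t * (1 / sqrt n * (3 / t\<^sup>2 + (2 / t + 4 / t ^ 3 + 1 / t\<^sup>2 + 8 / t ^ 4) / t))"
      using w_close_to_semicircle t0 by (intro mult_left_mono) (auto simp: h_def q_def v_def s_def)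
    also have "\<dots> \<le> T * (1 / sqrt n * (3 / d\<^sup>2 + (2 / d + 4 / d ^ 3 + 1 / d\<^sup>2 + 8 / d ^ 4) / d))"
      using t_mem d n by (intro mult_mono add_mono frac_le power_mono add_nonneg_nonneg divide_nonneg_nonneg) auto
    also have "\<dots> = C / sqrt n" by (simp add: C_def)
    finally show "?E (\<lambda>X. \<bar>t * (h t - Re (tr t X))\<bar>) \<le> C / sqrt n"
      by (simp only: tr_def)
  qed simp
  moreover have "?E (\<lambda>X. \<bar>pi / 2 * normalized_energy n X - J\<bar>) \<le> ?E (\<lambda>X. d + 1 / T + G X)"
  proof (intro integral_mono)
    fix X
    show "\<bar>pi / 2 * normalized_energy n X - J\<bar> \<le> d + 1 / T + G X"
      using I(2)[of X] IJ[of X] by linarith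
  qed auto
  ultimately show ?thesis by simp
qed

lemma normalized_energy_L1:
  assumes p: "0 < p" "p < 1"
  shows "(\<lambda>n. measure_pmf.expectation (bernoulli_product (vertex_pairs n) p)
     (\<lambda>X. \<bar>normalized_energy n X - 8 / (3 * pi) * sqrt (p * (1 - p))\<bar>)) \<longlonglongrightarrow> 0"
proof -
  let ?E = "\<lambda>n. measure_pmf.expectation (bernoulli_product (vertex_pairs n) p) :: _ \<Rightarrow> real"
  define q c where "q = p * (1 - p)" and "c = 4 / 3 * sqrt q"
  have q: "0 < q" using p by (simp add: q_def)
  define e where "e n = ?E n (\<lambda>X. \<bar>pi / 2 * normalized_energy n X - c\<bar>)" for n
  have "e \<longlonglongrightarrow> 0"
  proof (rule LIMSEQ_I)
    fix r :: real assume r: "0 < r"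
    have "\<forall>\<^sub>F d in at_right 0. dist (semicircle_primitive q (1 / d) - semicircle_primitive q d) c < r / 4"
      using semicircle_primitive_limit[OF q] r unfolding c_def
      by (intro tendstoD) auto
    moreover have "\<forall>\<^sub>F d in at_right 0. d < min 1 (r / 8)"
      using r by (intro order_tendstoD(2)[of _ 0]) (auto intro: tendsto_ident_at)
    moreover have "\<forall>\<^sub>F d :: real in at_right 0. 0 < d"
      by (rule eventually_at_right_less)
    ultimately have "\<forall>\<^sub>F d in at_right 0.
        dist (semicircle_primitive q (1 / d) - semicircle_primitive q d) c < r / 4 \<and> d < min 1 (r / 8) \<and> 0 < d"
      by eventually_elim auto
    from eventually_happens'[OF trivial_limit_at_right_real this]
    obtain d where d: "0 < d" "d < 1" "d < r / 8"
      "dist (semicircle_primitive q (1 / d) - semicircle_primitive q d) c < r / 4"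
      by auto
    \<comment> \<open>One parameter for both cutoffs; it is fixed before \<open>n\<close> tends to infinity.\<close>
    define T where "T = 1 / d"
    have dT: "d \<le> T" using d by (simp add: T_def field_simps mult_le_one power2_eq_square[symmetric] power_le_one)
    define J where "J = semicircle_primitive q T - semicircle_primitive q d"
    have T_inv: "1 / T = d" by (simp add: T_def)
    have Jc: "\<bar>J - c\<bar> < r / 4"
      using d(4) by (simp add: J_def T_def dist_real_def)
    define C where "C = T * (3 / d\<^sup>2 + (2 / d + 4 / d ^ 3 + 1 / d\<^sup>2 + 8 / d ^ 4) / d)"
    have "(\<lambda>n. C / sqrt n * (T - d)) \<longlonglongrightarrow> 0"
      by real_asymp
    then have "\<forall>\<^sub>F n in sequentially. C / sqrt n * (T - d) < r / 4"
      using r by (intro order_tendstoD(2)[of _ 0]) auto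
    then have "\<forall>\<^sub>F n in sequentially. norm (e n - 0) < r"
      using eventually_gt_at_top[of 0]
    proof eventually_elim
      case (elim n)
      have "e n \<le> ?E n (\<lambda>X. \<bar>pi / 2 * normalized_energy n X - J\<bar> + \<bar>J - c\<bar>)"
        unfolding e_def by (intro integral_mono) auto
      also have "\<dots> = ?E n (\<lambda>X. \<bar>pi / 2 * normalized_energy n X - J\<bar>) + \<bar>J - c\<bar>"
        by simp
      also have "\<dots> \<le> (d + 1 / T + C / sqrt n * (T - d)) + \<bar>J - c\<bar>"
        using energy_deviation[OF elim(2) p d(1) dT]
        by (intro add_right_mono) (simp add: C_def J_def q_def)
      also have "\<dots> < r"
        using elim(1) d(3) Jc unfolding T_inv by linarith
      finally show ?case
        by (simp add: e_def)
    qed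
    then show "\<exists>no. \<forall>n\<ge>no. norm (e n - 0) < r"
      by (simp add: eventually_sequentially)
  qed
  then have "(\<lambda>n. 2 / pi * e n) \<longlonglongrightarrow> 2 / pi * 0"
    by (rule tendsto_mult_left)
  moreover have "2 / pi * e n = ?E n (\<lambda>X. \<bar>normalized_energy n X - 8 / (3 * pi) * sqrt q\<bar>)" for n
  proof -
    have "2 / pi * \<bar>pi / 2 * x - c\<bar> = \<bar>x - 8 / (3 * pi) * sqrt q\<bar>" for x
    proof -
      have "2 / pi * \<bar>pi / 2 * x - c\<bar> = \<bar>2 / pi * (pi / 2 * x - c)\<bar>"
        by (simp only: abs_mult) simp
      also have "2 / pi * (pi / 2 * x - c) = x - 8 / (3 * pi) * sqrt q"
        by (simp add: c_def right_diff_distrib)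
      finally show ?thesis .
    qed
    then show ?thesis
      unfolding e_def integral_mult_right_zero[symmetric] by simp
  qed
  ultimately show ?thesis by (simp only: q_def mult_zero_right)
qed

section \<open>Graphs of diameter two\<close>

lemma graph_dist_eqI:
  assumes G: "pair_graph G"
    and walk: "pre_digraph.awalk (with_proj G) u es v"
    and shortest: "\<And>es'. pre_digraph.awalk (with_proj G) u es' v \<Longrightarrow> length es \<le> length es'"
  shows "graph_dist G u v = ereal (length es)"
proof -
  interpret pair_graph G by (rule G)
  have awalk_cost_unit: "awalk_cost (\<lambda>_. 1) p = real (length p)" for p
    by (induction p) auto
  show ?thesis
    unfolding graph_dist_def \<mu>_def
  proof (rule antisym)
    show "(INF p\<in>{p. awalk u p v}. ereal (awalk_cost (\<lambda>_. 1) p)) \<le> ereal (length es)"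
      using walk by (intro INF_lower2[of es]) (auto simp: awalk_cost_unit)
    show "ereal (length es) \<le> (INF p\<in>{p. awalk u p v}. ereal (awalk_cost (\<lambda>_. 1) p))"
      using shortest by (intro INF_greatest) (auto simp: awalk_cost_unit)
  qed
qed

text \<open>
  Adjacent vertices, too, are required to have a common neighbour. This is more than diameter two, but
  it still holds with probability tending to one, and it allows a
  union bound in which every pair of vertices is treated in the same way.
\<close>

definition strong_diameter_two :: "nat \<Rightarrow> (nat set \<Rightarrow> bool) \<Rightarrow> bool" where
  "strong_diameter_two n X \<longleftrightarrow>
     (\<exists>a<n. \<exists>b<n. a \<noteq> b \<and> \<not> X {a, b}) \<and>
     (\<forall>a<n. \<forall>b<n. a \<noteq> b \<longrightarrow> (\<exists>c<n. c \<noteq> a \<and> c \<noteq> b \<and> X {a, c} \<and> X {c, b}))"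

lemma arc_graph_of_edges:
  "(a, b) \<in> parcs (graph_of_edges n X) \<longleftrightarrow> a < n \<and> b < n \<and> a \<noteq> b \<and> X {a, b}"
  by (auto simp: graph_of_edges_def vertex_pairs_def card_2_iff doubleton_eq_iff)

lemma graph_dist_strong_diameter_two:
  assumes X: "strong_diameter_two n X" and ab: "a < n" "b < n"
  shows "graph_dist (graph_of_edges n X) a b = ereal (if a = b then 0 else if X {a, b} then 1 else 2)"
proof -
  define G where "G = graph_of_edges n X"
  have G: "pair_graph G" unfolding G_def by (rule pair_graph_graph_of_edges)
  interpret pair_graph G by (rule G)
  have V: "pverts G = {..<n}" by (simp add: G_def graph_of_edges_def)
  have arc: "(i, j) \<in> parcs G \<longleftrightarrow> i < n \<and> j < n \<and> i \<noteq> j \<and> X {i, j}" for i j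
    unfolding G_def by (rule arc_graph_of_edges)
  have walk: "awalk i es j \<longleftrightarrow> i < n \<and> set es \<subseteq> parcs G \<and> cas i es j" for i es j
    by (simp add: awalk_def V)
  consider "a = b" | "a \<noteq> b" "X {a, b}" | "a \<noteq> b" "\<not> X {a, b}" by blast
  then have "graph_dist G a b = ereal (if a = b then 0 else if X {a, b} then 1 else 2)"
  proof cases
    case 1
    have "graph_dist G a b = ereal (length ([] :: (nat \<times> nat) list))"
      by (rule graph_dist_eqI[OF G]) (use 1 ab in \<open>auto simp: walk\<close>)
    then show ?thesis using 1 by simp
  next
    case 2
    have "graph_dist G a b = ereal (length [(a, b)])"
    proof (rule graph_dist_eqI[OF G])
      show "awalk a [(a, b)] b" using 2 ab by (auto simp: walk arc)
      fix es assume "awalk a es b"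
      then show "length [(a, b)] \<le> length es" using 2 by (cases es) (auto simp: walk)
    qed
    then show ?thesis using 2 by simp
  next
    case 3
    then obtain c where c: "c < n" "c \<noteq> a" "c \<noteq> b" "X {a, c}" "X {c, b}"
      using X ab by (auto simp: strong_diameter_two_def)
    have "graph_dist G a b = ereal (length [(a, c), (c, b)])"
    proof (rule graph_dist_eqI[OF G])
      show "awalk a [(a, c), (c, b)] b" using 3 ab c by (auto simp: walk arc)
      fix es assume es: "awalk a es b"
      have "es \<noteq> []" using es 3 by (auto simp: walk)
      moreover have "es \<noteq> [e]" for e using es 3 by (cases e) (auto simp: walk arc)
      ultimately show "length [(a, c), (c, b)] \<le> length es"
        by (cases es rule: remdups_adj.cases) auto
    qed
    then show ?thesis using 3 by simp
  qed
  then show ?thesis by (simp add: G_def)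
qed

lemma graph_diameter_strong_diameter_two:
  assumes X: "strong_diameter_two n X"
  shows "graph_diameter (graph_of_edges n X) = 2"
proof -
  have V: "pverts (graph_of_edges n X) = {..<n}" by (simp add: graph_of_edges_def)
  obtain a b where ab: "a < n" "b < n" "a \<noteq> b" "\<not> X {a, b}"
    using X by (auto simp: strong_diameter_two_def)
  show ?thesis unfolding graph_diameter_def V
  proof (rule antisym)
    show "(SUP u\<in>{..<n}. SUP v\<in>{..<n}. graph_dist (graph_of_edges n X) u v) \<le> 2"
      by (intro SUP_least) (auto simp: graph_dist_strong_diameter_two[OF X] numeral_eq_ereal)
    have "2 = graph_dist (graph_of_edges n X) a b"
      using ab by (simp add: graph_dist_strong_diameter_two[OF X])
    also have "\<dots> \<le> (SUP v\<in>{..<n}. graph_dist (graph_of_edges n X) a v)"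
      using ab by (intro SUP_upper) auto
    also have "\<dots> \<le> (SUP u\<in>{..<n}. SUP v\<in>{..<n}. graph_dist (graph_of_edges n X) u v)"
      using ab by (intro SUP_upper) auto
    finally show "2 \<le> (SUP u\<in>{..<n}. SUP v\<in>{..<n}. graph_dist (graph_of_edges n X) u v)" .
  qed
qed

lemma reverse_wiener_strong_diameter_two:
  assumes X: "strong_diameter_two n X"
  shows "reverse_wiener (graph_of_edges n X) = adjacency_mat n X"
proof -
  have V: "pverts (graph_of_edges n X) = {..<n}" by (simp add: graph_of_edges_def)
  show ?thesis
    unfolding reverse_wiener_def V graph_diameter_strong_diameter_two[OF X]
    by (intro eq_matI) (auto simp: adjacency_mat_def graph_dist_strong_diameter_two[OF X])
qed

text \<open>
  The edges \<open>{a, c}\<close> and \<open>{c, b}\<close> for different \<open>c\<close> are all different, so the factors are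
  independent; the induction integrates out two edges at a time.
\<close>

lemma no_common_neighbour_prob:
  assumes p: "0 \<le> p" "p \<le> 1" and C: "C \<subseteq> {..<n} - {a, b}" and ab: "a < n" "b < n" "a \<noteq> b"
  shows "measure_pmf.expectation (bernoulli_product (vertex_pairs n) p)
     (\<lambda>X. \<Prod>c\<in>C. 1 - of_bool (X {a, c}) * of_bool (X {c, b})) = (1 - p\<^sup>2) ^ card C"
proof -
  have "finite C" using C finite_subset by blast
  then show ?thesis using C
  proof (induction C rule: finite_induct)
    case empty
    then show ?case by simp
  next
    case (insert c C)
    let ?E = "measure_pmf.expectation (bernoulli_product (vertex_pairs n) p) :: _ \<Rightarrow> real"
    define f where "f X = (\<Prod>c\<in>C. 1 - of_bool (X {a, c}) * of_bool (X {c, b}) :: real)" for X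
    have c: "c < n" "c \<noteq> a" "c \<noteq> b" "c \<notin> C" "C \<subseteq> {..<n} - {a, b}" using insert by auto
    have indep1: "f (X({a, c} := v)) = f X" and indep2: "f (X({c, b} := v)) = f X" for X v
      unfolding f_def using c ab by (auto intro!: prod.cong simp: doubleton_eq_iff)
    have edges: "{a, c} \<in> vertex_pairs n" "{c, b} \<in> vertex_pairs n"
      using c ab by (auto simp: vertex_pairs_def)
    have "?E (\<lambda>X. of_bool (X {a, c}) * (of_bool (X {c, b}) * f X)) = p * ?E (\<lambda>X. of_bool (X {c, b}) * f X)"
      using edges p c ab
      by (intro expectation_bit_times_indep) (auto simp: indep1 doubleton_eq_iff)
    also have "?E (\<lambda>X. of_bool (X {c, b}) * f X) = p * ?E f"
      using edges p by (intro expectation_bit_times_indep) (auto simp: indep2)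
    finally have both: "?E (\<lambda>X. of_bool (X {a, c}) * (of_bool (X {c, b}) * f X)) = p\<^sup>2 * ?E f"
      by (simp add: power2_eq_square)
    have "?E (\<lambda>X. \<Prod>c\<in>insert c C. 1 - of_bool (X {a, c}) * of_bool (X {c, b})) =
        ?E (\<lambda>X. f X - of_bool (X {a, c}) * (of_bool (X {c, b}) * f X))"
      using insert.hyps by (simp add: f_def algebra_simps)
    also have "\<dots> = ?E f - ?E (\<lambda>X. of_bool (X {a, c}) * (of_bool (X {c, b}) * f X))"
      by (intro Bochner_Integration.integral_diff) auto
    also have "\<dots> = (1 - p\<^sup>2) * ?E f"
      unfolding both by (simp add: algebra_simps)
    also have "?E f = (1 - p\<^sup>2) ^ card C"
      unfolding f_def using c by (intro insert.IH) auto
    finally show ?case using insert.hyps by simp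
  qed
qed

lemma all_edges_at_vertex_prob:
  assumes p: "0 \<le> p" "p \<le> 1" and C: "C \<subseteq> {..<n} - {0}" 
  shows "measure_pmf.expectation (bernoulli_product (vertex_pairs n) p)
     (\<lambda>X. \<Prod>c\<in>C. of_bool (X {0, c})) = p ^ card C"
proof -
  have "finite C" using C finite_subset by blast
  then show ?thesis using C
  proof (induction C rule: finite_induct)
    case (insert c C)
    then have "measure_pmf.expectation (bernoulli_product (vertex_pairs n) p)
        (\<lambda>X. of_bool (X {0, c}) * (\<Prod>c\<in>C. of_bool (X {0, c}))) =
      p * measure_pmf.expectation (bernoulli_product (vertex_pairs n) p) (\<lambda>X. \<Prod>c\<in>C. of_bool (X {0, c}))"
      using p by (intro expectation_bit_times_indep)
        (auto simp: vertex_pairs_def doubleton_eq_iff intro!: prod.cong)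
    then show ?case using insert by simp
  qed simp
qed

text \<open>
  A union bound over the ordered pairs, plus the event that the graph is complete, which forces
  all edges at the vertex 0 to be present.
\<close>

lemma prob_not_strong_diameter_two:
  assumes n: "0 < n" and p: "0 \<le> p" "p \<le> 1"
  shows "measure_pmf.prob (bernoulli_product (vertex_pairs n) p) {X. \<not> strong_diameter_two n X}
    \<le> p ^ (n - 1) + (real n)\<^sup>2 * (1 - p\<^sup>2) ^ (n - 2)"
proof -
  let ?E = "measure_pmf.expectation (bernoulli_product (vertex_pairs n) p) :: _ \<Rightarrow> real"
  define f where "f X = (\<Prod>c\<in>{..<n} - {0}. of_bool (X {0, c}) :: real)" for X :: "nat set \<Rightarrow> bool"
  define g where "g a b X = (\<Prod>c\<in>{..<n} - {a, b}. 1 - of_bool (X {a, c}) * of_bool (X {c, b}) :: real)"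
    for a b and X :: "nat set \<Rightarrow> bool"
  have g_nonneg: "0 \<le> g a b X" for a b X
    unfolding g_def by (intro prod_nonneg) auto
  have "measure_pmf.prob (bernoulli_product (vertex_pairs n) p) {X. \<not> strong_diameter_two n X} =
      ?E (indicator {X. \<not> strong_diameter_two n X})"
    by simp
  also have "\<dots> \<le> ?E (\<lambda>X. f X + (\<Sum>(a, b)\<in>off_diag n. g a b X))"
  proof (intro integral_mono)
    fix X
    have nonneg: "0 \<le> f X" "0 \<le> (\<Sum>(a, b)\<in>off_diag n. g a b X)"
      by (auto simp: f_def intro!: prod_nonneg sum_nonneg g_nonneg)
    show "indicator {X. \<not> strong_diameter_two n X} X \<le> f X + (\<Sum>(a, b)\<in>off_diag n. g a b X)"
    proof (cases "strong_diameter_two n X")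
      case True
      then show ?thesis using nonneg by simp
    next
      case False
      then consider "\<forall>a<n. \<forall>b<n. a \<noteq> b \<longrightarrow> X {a, b}"
        | a b where "a < n" "b < n" "a \<noteq> b" "\<And>c. c < n \<Longrightarrow> c \<noteq> a \<Longrightarrow> c \<noteq> b \<Longrightarrow> \<not> (X {a, c} \<and> X {c, b})"
        unfolding strong_diameter_two_def by blast
      then have "1 \<le> f X + (\<Sum>(a, b)\<in>off_diag n. g a b X)"
      proof cases
        case 1
        then have "f X = 1" using n unfolding f_def by (intro prod.neutral) auto
        then show ?thesis using nonneg by simp
      next
        case (2 a b)
        have "1 = g a b X" unfolding g_def using 2(4) by (intro prod.neutral[symmetric]) auto
        also have "\<dots> = (\<lambda>(a, b). g a b X) (a, b)" by simp
        also have "\<dots> \<le> (\<Sum>(a, b)\<in>off_diag n. g a b X)"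
          by (rule member_le_sum) (use 2 g_nonneg in \<open>auto simp: off_diag_def\<close>)
        finally show ?thesis using nonneg by simp
      qed
      then show ?thesis using False by simp
    qed
  qed (auto simp: vertex_pairs_def)
  also have "\<dots> = ?E f + (\<Sum>(a, b)\<in>off_diag n. ?E (g a b))"
    by (simp add: case_prod_beta')
  also have "?E f = p ^ (n - 1)"
    unfolding f_def using n by (subst all_edges_at_vertex_prob[OF p]) auto
  also have "(\<Sum>(a, b)\<in>off_diag n. ?E (g a b)) = (\<Sum>(a, b)\<in>off_diag n. (1 - p\<^sup>2) ^ (n - 2))"
  proof (intro sum.cong refl, clarify)
    fix a b assume "(a, b) \<in> off_diag n"
    then have ab: "a < n" "b < n" "a \<noteq> b" by (auto simp: off_diag_def)
    have "card ({..<n} - {a, b}) = n - 2"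
      using ab by (subst card_Diff_subset) auto
    then show "?E (g a b) = (1 - p\<^sup>2) ^ (n - 2)"
      unfolding g_def using no_common_neighbour_prob[OF p subset_refl ab] by simp
  qed
  also have "\<dots> = real (card (off_diag n)) * (1 - p\<^sup>2) ^ (n - 2)"
    by (simp add: case_prod_beta')
  also have "\<dots> \<le> (real n)\<^sup>2 * (1 - p\<^sup>2) ^ (n - 2)"
    using p by (intro mult_right_mono card_off_diag zero_le_power) (simp add: power_le_one)
  finally show ?thesis by simp
qed

lemma prob_not_strong_diameter_two_tendsto:
  assumes p: "0 < p" "p < 1"
  shows "(\<lambda>n. measure_pmf.prob (bernoulli_product (vertex_pairs n) p) {X. \<not> strong_diameter_two n X}) \<longlonglongrightarrow> 0"
proof (rule tendsto_sandwich[OF _ _ tendsto_const])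
  define x where "x = 1 - p\<^sup>2"
  have x: "0 < x" "x < 1" using p by (auto simp: x_def power_less_one_iff)
  show "\<forall>\<^sub>F n in sequentially. 0 \<le> measure_pmf.prob (bernoulli_product (vertex_pairs n) p) {X. \<not> strong_diameter_two n X}"
    by simp
  show "\<forall>\<^sub>F n in sequentially. measure_pmf.prob (bernoulli_product (vertex_pairs n) p) {X. \<not> strong_diameter_two n X} \<le>
      p ^ (n - 1) + (real n * sqrt x ^ n)\<^sup>2 / x\<^sup>2"
    using eventually_ge_at_top[of 2]
  proof eventually_elim
    case (elim n)
    \<comment> \<open>The square root splits \<open>n\<^sup>2 * x ^ n\<close> into the square of a sequence \<open>n * y ^ n\<close> tending to 0.\<close>
    have "(sqrt x ^ n)\<^sup>2 = x ^ n"
      using x by (simp flip: power_mult power_mult_distrib add: power2_eq_square)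
    also have "\<dots> = x\<^sup>2 * x ^ (n - 2)"
      using elim by (metis le_add_diff_inverse power_add)
    finally have "(real n * sqrt x ^ n)\<^sup>2 / x\<^sup>2 = (real n)\<^sup>2 * x ^ (n - 2)"
      using x by (simp add: power_mult_distrib)
    then show ?case
      using prob_not_strong_diameter_two[of n p] elim p by (simp add: x_def)
  qed
  have "(\<lambda>n. real n * sqrt x ^ n) \<longlonglongrightarrow> 0"
    using x by (intro powser_times_n_limit_0) auto
  then have "(\<lambda>n. (real n * sqrt x ^ n)\<^sup>2 / x\<^sup>2) \<longlonglongrightarrow> 0\<^sup>2 / x\<^sup>2"
    using x by (intro tendsto_intros) auto
  moreover have "(\<lambda>n. p ^ (n - 1)) \<longlonglongrightarrow> 0"
    using p by (subst filterlim_sequentially_Suc[symmetric]) (auto intro: LIMSEQ_realpow_zero)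
  ultimately show "(\<lambda>n. p ^ (n - 1) + (real n * sqrt x ^ n)\<^sup>2 / x\<^sup>2) \<longlonglongrightarrow> 0"
    using tendsto_add[of "\<lambda>n. p ^ (n - 1)" 0 sequentially] by simp
qed

section \<open>Energy of the reverse Wiener matrix\<close>

theorem corollary3p5:
  fixes p :: real
  assumes "0 < p" and "p < 1"
  shows "\<exists>\<epsilon> :: nat \<Rightarrow> real. \<epsilon> \<longlonglongrightarrow> 0 \<and>
    (\<lambda>n. measure_pmf.prob (gnp_pmf n p)
       {G. \<exists>\<delta>. \<bar>\<delta>\<bar> \<le> \<epsilon> n \<and>
          matrix_energy (reverse_wiener G)
            = (8 / (3 * pi) * sqrt (p * (1 - p)) + \<delta>) * real n powr (3 / 2)})
    \<longlonglongrightarrow> 1"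
proof -
  let ?P = "\<lambda>n. bernoulli_product (vertex_pairs n) p"
  define c where "c = 8 / (3 * pi) * sqrt (p * (1 - p))"
  define L where "L n = measure_pmf.expectation (?P n) (\<lambda>X. \<bar>normalized_energy n X - c\<bar>)" for n
  \<comment> \<open>Markov's inequality at the level \<open>sqrt (L n)\<close> gives the probability \<open>sqrt (L n)\<close>; the second
    summand only keeps the level positive.\<close>
  define \<epsilon> where "\<epsilon> n = sqrt (L n) + 1 / real (Suc n)" for n
  define D where "D n = measure_pmf.prob (?P n) {X. \<not> strong_diameter_two n X}" for n
  define A where "A n = {G. \<exists>\<delta>. \<bar>\<delta>\<bar> \<le> \<epsilon> n \<and>
    matrix_energy (reverse_wiener G) = (c + \<delta>) * real n powr (3 / 2)}" for n
  have L0: "0 \<le> L n" for n by (simp add: L_def)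
  have L: "(\<lambda>n. sqrt (L n)) \<longlonglongrightarrow> 0"
    using tendsto_real_sqrt[OF normalized_energy_L1[OF assms]] by (simp add: L_def c_def)
  have "\<epsilon> \<longlonglongrightarrow> 0"
    unfolding \<epsilon>_def using tendsto_add[OF L LIMSEQ_Suc[OF lim_1_over_n]] by simp
  have lower: "1 - (D n + sqrt (L n)) \<le> measure_pmf.prob (gnp_pmf n p) (A n)" if n: "0 < n" for n
  proof -
    define B where "B = {X. \<epsilon> n \<le> \<bar>normalized_energy n X - c\<bar>}"
    have \<epsilon>: "0 < \<epsilon> n" "sqrt (L n) \<le> \<epsilon> n"
      using L0[of n] by (auto simp: \<epsilon>_def add_nonneg_pos)
    have "measure_pmf.prob (?P n) B \<le> L n / \<epsilon> n"
      using integral_Markov_inequality_measure[of "?P n" "\<lambda>X. \<bar>normalized_energy n X - c\<bar>" "{}" "\<epsilon> n"] \<epsilon>(1)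
      by (simp add: B_def L_def)
    also have "\<dots> \<le> sqrt (L n)"
    proof -
      have "L n = sqrt (L n) * sqrt (L n)" using L0 by simp
      also have "\<dots> \<le> sqrt (L n) * \<epsilon> n" using \<epsilon> L0 by (intro mult_left_mono) auto
      finally show ?thesis using \<epsilon>(1) by (simp add: pos_divide_le_eq)
    qed
    finally have B: "measure_pmf.prob (?P n) B \<le> sqrt (L n)" .
    have "UNIV = graph_of_edges n -` A n \<union> ({X. \<not> strong_diameter_two n X} \<union> B)"
    proof -
      have "graph_of_edges n X \<in> A n" if X: "strong_diameter_two n X" "X \<notin> B" for X
      proof -
        have "real n powr (3 / 2) = real n * sqrt (real n)"
          using n powr_add[of "real n" 1 "1 / 2"] by (simp add: powr_half_sqrt)
        then have "matrix_energy (reverse_wiener (graph_of_edges n X)) =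
            (c + (normalized_energy n X - c)) * real n powr (3 / 2)"
          using n by (simp add: reverse_wiener_strong_diameter_two[OF X(1)] normalized_energy_def)
        moreover have "\<bar>normalized_energy n X - c\<bar> \<le> \<epsilon> n"
          using X(2) by (simp add: B_def)
        ultimately show ?thesis unfolding A_def by blast
      qed
      then show ?thesis by auto
    qed
    then have "1 = measure_pmf.prob (?P n) (graph_of_edges n -` A n \<union> ({X. \<not> strong_diameter_two n X} \<union> B))"
      using measure_pmf.prob_space[of "?P n"] by simp
    also have "\<dots> \<le> measure_pmf.prob (?P n) (graph_of_edges n -` A n) +
        (D n + measure_pmf.prob (?P n) B)"
      unfolding D_def
      by (intro order.trans[OF measure_Un_le] add_left_mono) auto
    finally show ?thesis
      using B by (simp add: gnp_pmf_def)
  qed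
  have "(\<lambda>n. 1 - (D n + sqrt (L n))) \<longlonglongrightarrow> 1 - (0 + 0)"
    unfolding D_def by (intro tendsto_intros prob_not_strong_diameter_two_tendsto assms L)
  then have lower_lim: "(\<lambda>n. 1 - (D n + sqrt (L n))) \<longlonglongrightarrow> 1" by simp
  have "(\<lambda>n. measure_pmf.prob (gnp_pmf n p) (A n)) \<longlonglongrightarrow> 1"
  proof (rule tendsto_sandwich[OF _ _ lower_lim tendsto_const])
    show "\<forall>\<^sub>F n in sequentially. 1 - (D n + sqrt (L n)) \<le> measure_pmf.prob (gnp_pmf n p) (A n)"
      using eventually_gt_at_top[of 0] by eventually_elim (rule lower)
    show "\<forall>\<^sub>F n in sequentially. measure_pmf.prob (gnp_pmf n p) (A n) \<le> 1"
      by simp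
  qed
  with \<open>\<epsilon> \<longlonglongrightarrow> 0\<close>
  have "\<epsilon> \<longlonglongrightarrow> 0 \<and> (\<lambda>n. measure_pmf.prob (gnp_pmf n p) (A n)) \<longlonglongrightarrow> 1" ..
  then show ?thesis
    unfolding A_def c_def by (rule exI[of _ \<epsilon>])
qed

end
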